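(* Let $n\ge 3$ and let $\Theta$ be a constant with $|\Theta|\ge \frac{\pi}{2}(n-2)$. Let $f$ be smooth and positive in $B_2(0)\subset\mathbb{R}^n$, and let $u$ be a smooth solution in $B_2(0)$ of $$\sum_{i=1}^{n}\arctan\frac{\lambda_i}{f(x)}=\Theta ,$$ where $\lambda_1\ge\cdots\ge\lambda_n$ are the eigenvalues of $D^2u(x)$. Then $$|Du(0)|\le C(n)\Big(\big\|Df/f\big\|_{L^\infty(B_1(0))}^2+1\Big)\,\mathrm{osc}_{B_1(0)}u ,$$ where $C(n)$ is a constant depending only on $n$.
   Context: $B_r(0)$ is the open ball of radius $r$ centered at the origin of $\mathbb{R}^n$. $\mathrm{osc}_{B}u=\sup_B u-\inf_B u$. *)

theory Defs
  imports "HOL-Analysis.Analysis" "HOL-Probability.Essential_Supremum"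
begin

text \<open>
  Functions of class \<open>C\<^sup>k\<close> on an open set \<open>S\<close>; values outside \<open>S\<close> play no role.
\<close>
primrec Ck_on :: "nat \<Rightarrow> ('a::euclidean_space \<Rightarrow> real) \<Rightarrow> 'a set \<Rightarrow> bool" where
  "Ck_on 0 f S = continuous_on S f"
| "Ck_on (Suc k) f S =
    ((\<forall>x\<in>S. f differentiable (at x)) \<and>
     (\<forall>v. Ck_on k (\<lambda>x. frechet_derivative f (at x) v) S))"

definition smooth_on :: "('a::euclidean_space \<Rightarrow> real) \<Rightarrow> 'a set \<Rightarrow> bool" where
  "smooth_on f S \<longleftrightarrow> (\<forall>k. Ck_on k f S)"

definition partial_deriv :: "'n \<Rightarrow> (real ^ 'n \<Rightarrow> real) \<Rightarrow> real ^ 'n \<Rightarrow> real" where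
  "partial_deriv i f x = frechet_derivative f (at x) (axis i 1)"

definition grad :: "(real ^ 'n \<Rightarrow> real) \<Rightarrow> real ^ 'n \<Rightarrow> real ^ 'n" where
  "grad f x = (\<chi> i. partial_deriv i f x)"

definition hessian :: "(real ^ 'n \<Rightarrow> real) \<Rightarrow> real ^ 'n \<Rightarrow> real ^ 'n ^ 'n" where
  "hessian f x = (\<chi> i j. partial_deriv i (partial_deriv j f) x)"

definition charpoly :: "'a::comm_ring_1 ^ 'n ^ 'n \<Rightarrow> 'a poly" where
  "charpoly A = det (mat [:0, 1:] - (\<chi> i j. [:A $ i $ j:]))"

text \<open>
  The real eigenvalues in decreasing order, repeated according to (algebraic) multiplicity.
  For a symmetric matrix this list has length \<open>CARD('n)\<close>, and its entry with index \<open>i\<close>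
  (counted from 0) is the eigenvalue \<open>\<lambda>\<^bsub>i+1\<^esub>\<close>.
\<close>
definition eigenvalues :: "real ^ 'n ^ 'n \<Rightarrow> real list" where
  "eigenvalues A = rev (sorted_list_of_multiset (proots (charpoly A)))"

text \<open>
  The conversion from \<open>ereal\<close> sends infinity to 0, so this is the \<open>L\<^sup>\<infinity>\<close> norm only for
  functions that are measurable and essentially bounded on \<open>S\<close>. It is applied to functions
  continuous on a neighbourhood of the closure of a bounded set \<open>S\<close>.
\<close>
definition Linf_norm :: "'a::euclidean_space set \<Rightarrow> ('a \<Rightarrow> 'b::real_normed_vector) \<Rightarrow> real" where
  "Linf_norm S g = real_of_ereal (esssup (lebesgue_on S) (\<lambda>x. ereal (norm (g x))))"

text \<open>Meaningful for functions bounded on \<open>S\<close>.\<close>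
definition osc :: "'a set \<Rightarrow> ('a \<Rightarrow> real) \<Rightarrow> real" where
  "osc S u = (SUP x\<in>S. u x) - (INF x\<in>S. u x)"

end

theory Submission
  imports Defs
begin

text \<open>
  The proof is a maximum principle argument. Replacing \<open>u\<close> by \<open>- u\<close> reverses the sign of the
  phase, so let \<open>\<Theta> \<ge> (n - 2) \<pi> / 2\<close>. For \<open>M\<close> slightly larger than the oscillation, some shift
  \<open>v = u - c\<close> takes values in \<open>[M, 2 M]\<close>. Put \<open>A = 2 n / M\<close> and consider a maximum point \<open>x\<^sub>0\<close>
  over the closed unit ball of
  \<open>w = \<eta> \<bar>Du\<bar> + A v\<^sup>2 / 2\<close> with \<open>\<eta> = 1 - \<bar>x\<bar>\<^sup>2\<close>.
  The second summand is at most \<open>4 n M\<close>, so \<open>\<bar>Du(0)\<bar> \<le> w(0) \<le> w(x\<^sub>0)\<close> reduces everything to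
  a bound for \<open>\<eta> D\<close> at \<open>x\<^sub>0\<close>, where \<open>D = \<bar>Du(x\<^sub>0)\<bar>\<close>, and only the case \<open>\<eta> D > 0\<close> matters.

  Work at \<open>x\<^sub>0\<close> in an orthonormal basis of eigenvectors of the Hessian, with eigenvalues \<open>\<lambda>\<^sub>i\<close>
  and \<open>F\<^sub>i = f / (f\<^sup>2 + \<lambda>\<^sub>i\<^sup>2)\<close>. Three facts carry the estimate.

  \<^item> Along each basis direction \<open>w\<close> satisfies the first and second order conditions for a maximum
    (\<open>maximum_along_line_conditions\<close>). The second order condition contains the good terms
    \<open>\<eta> D A u\<^sub>i\<^sup>2\<close> and \<open>\<eta>\<^sup>2 \<lambda>\<^sub>i\<^sup>2\<close>, and the third derivatives \<open>\<Sum>\<^sub>k u\<^sub>k u\<^sub>k\<^sub>i\<^sub>i\<close>.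

  \<^item> The equation, differentiated once, gives
    \<open>\<Sum>\<^sub>i F\<^sub>i u\<^sub>k\<^sub>i\<^sub>i = (f\<^sub>k / f) \<Sum>\<^sub>i F\<^sub>i \<lambda>\<^sub>i\<close> (\<open>linearized_phase_equation\<close>). Eigenvalues need not be
    differentiable, but the equation implies that \<open>det (f I + \<i> D\<^sup>2u)\<close> has argument \<open>\<Theta>\<close>, and this
    determinant is a polynomial in smooth functions.

  \<^item> Because the phase is large, the sum of any two eigenvalues is nonnegative
    (\<open>pairwise_sum_nonneg\<close>). In a direction \<open>k\<close> with \<open>u\<^sub>k\<^sup>2 \<ge> D\<^sup>2 / n\<close> the first order condition
    and \<open>A v \<ge> 2 n\<close> force \<open>\<lambda>\<^sub>k < 0\<close>; hence \<open>\<bar>\<lambda>\<^sub>k\<bar> \<le> \<bar>\<lambda>\<^sub>i\<bar>\<close> and \<open>F\<^sub>i \<le> F\<^sub>k\<close> for all \<open>i\<close>.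

  Summing the second order conditions with weights \<open>F\<^sub>i\<close>, the third derivatives become a term of
  size at most \<open>\<eta>\<^sup>2 D K \<Sum>\<^sub>i F\<^sub>i \<bar>\<lambda>\<^sub>i\<bar>\<close>, where \<open>K\<close> bounds \<open>\<bar>Df\<bar> / f\<close>. By Young's inequality it is
  absorbed by the good term in \<open>\<lambda>\<^sub>i\<^sup>2\<close> at the cost of \<open>D\<^sup>2 K\<^sup>2 \<Sum>\<^sub>i F\<^sub>i\<close>; this is where the square
  of \<open>K\<close> comes from. All other terms are at most a multiple of \<open>D\<^sup>2 \<Sum>\<^sub>i F\<^sub>i \<le> n D\<^sup>2 F\<^sub>k\<close>, while the
  left hand side is at least \<open>\<eta> D A F\<^sub>k D\<^sup>2 / n\<close>. Dividing by \<open>F\<^sub>k D\<^sup>2\<close> bounds \<open>\<eta> D A\<close>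
  (\<open>gradient_bound_from_conditions\<close>).
\<close>

section \<open>Spectral decomposition of symmetric matrices\<close>

text \<open>
  A maximum point \<open>x\<close> of the quadratic form \<open>x \<bullet> T x\<close> on the unit sphere of \<open>S\<close> is an
  eigenvector: comparing \<open>x\<close> with \<open>x + t w\<close>, where \<open>w = T x - (x \<bullet> T x) x\<close>, to first order
  in \<open>t\<close> shows \<open>w \<bullet> w = 0\<close>.
\<close>

lemma selfadjoint_eigenvector:
  fixes T :: "'a::euclidean_space \<Rightarrow> 'a"
  assumes lin: "linear T" and adj: "\<And>x y. T x \<bullet> y = x \<bullet> T y"
    and sub: "subspace S" and inv: "\<And>x. x \<in> S \<Longrightarrow> T x \<in> S" and ne: "y \<in> S" "y \<noteq> 0"
  shows "\<exists>x\<in>S. norm x = 1 \<and> (\<exists>m. T x = m *\<^sub>R x)"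
proof -
  let ?K = "S \<inter> sphere 0 1"
  have "compact ?K"
    using closed_subspace[OF sub] by (simp add: closed_Int_compact)
  moreover have "y /\<^sub>R norm y \<in> ?K"
    using ne sub by (simp add: subspace_scale)
  moreover have "continuous_on ?K (\<lambda>x. x \<bullet> T x)"
    using lin by (intro continuous_intros linear_continuous_on linear_conv_bounded_linear[THEN iffD1])
  ultimately obtain x where x: "x \<in> ?K" and max: "\<And>z. z \<in> ?K \<Longrightarrow> z \<bullet> T z \<le> x \<bullet> T x"
    by (metis continuous_attains_sup empty_iff)
  define m where "m = x \<bullet> T x"
  have xx: "x \<bullet> x = 1" using x by (simp add: norm_eq_1)
  have quad: "z \<bullet> T z \<le> m * (z \<bullet> z)" if "z \<in> S" for z
  proof (cases "z = 0")
    case True then show ?thesis using lin by (simp add: linear_0)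
  next
    case False
    have "(z /\<^sub>R norm z) \<bullet> T (z /\<^sub>R norm z) \<le> m"
      unfolding m_def using False that sub by (intro max) (simp add: subspace_scale)
    then have "(z \<bullet> T z) / (norm z)\<^sup>2 \<le> m"
      using lin by (simp add: linear_scale power2_eq_square divide_inverse mult_ac)
    then show ?thesis
      using False by (simp add: divide_le_eq power2_norm_eq_inner)
  qed
  define w where "w = T x - m *\<^sub>R x"
  have wS: "w \<in> S" unfolding w_def using x inv sub by (auto intro: subspace_diff subspace_scale)
  have xw: "x \<bullet> w = 0" by (simp add: w_def inner_diff_right m_def xx)
  have Txw: "T x \<bullet> w = w \<bullet> w"
    using xw by (simp add: w_def inner_diff_left inner_diff_right inner_commute)
  \<comment> \<open>The Rayleigh quotient inequality at \<open>x + t w\<close> reads \<open>2 t (w \<bullet> w) \<le> t\<^sup>2 c\<close>.\<close>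
  define c where "c = m * (w \<bullet> w) - w \<bullet> T w"
  have key: "2 * t * (w \<bullet> w) \<le> t\<^sup>2 * c" for t
  proof -
    have "(x + t *\<^sub>R w) \<bullet> T (x + t *\<^sub>R w) \<le> m * ((x + t *\<^sub>R w) \<bullet> (x + t *\<^sub>R w))"
      using x wS sub by (intro quad subspace_add subspace_scale) auto
    then show ?thesis
      using lin xw Txw adj[of x w]
      by (simp add: linear_add linear_scale inner_add_left inner_add_right xx m_def[symmetric]
          inner_commute c_def algebra_simps power2_eq_square)
  qed
  have "w \<bullet> w = 0"
  proof (rule ccontr)
    assume "w \<bullet> w \<noteq> 0"
    then have pos: "w \<bullet> w > 0" by (simp add: order_less_le)
    define t where "t = (w \<bullet> w) / (\<bar>c\<bar> + 1)"
    have t: "t > 0" using pos by (simp add: t_def add_nonneg_pos)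
    have "2 * (w \<bullet> w) \<le> t * c" using key[of t] t by (simp add: power2_eq_square)
    also have "\<dots> \<le> t * (\<bar>c\<bar> + 1)" using t by simp
    also have "\<dots> = w \<bullet> w" by (simp add: t_def)
    finally show False using pos by simp
  qed
  then show ?thesis using x by (auto simp: w_def)
qed

text \<open>
  Indexing the basis by the same type as the coordinates makes the basis vectors correspond to
  diagonal entries of matrices.
\<close>

definition orthonormal_frame :: "('n \<Rightarrow> real ^ 'n) \<Rightarrow> bool" where
  "orthonormal_frame e \<longleftrightarrow> (\<forall>i j. e i \<bullet> e j = (if i = j then 1 else 0))"

lemma orthonormal_frame_inner:
  fixes e :: "'n::finite \<Rightarrow> real ^ 'n"
  assumes "orthonormal_frame e"
  shows "x \<bullet> y = (\<Sum>i\<in>UNIV. (x \<bullet> e i) * (y \<bullet> e i))"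
proof -
  define P where "P = (\<chi> i. e i)"
  have "P ** transpose P = mat 1"
    using assms by (simp add: P_def vec_eq_iff matrix_matrix_mult_def transpose_def mat_def
        orthonormal_frame_def inner_vec_def)
  then have PP: "transpose P ** P = mat 1"
    by (simp add: matrix_left_right_inverse)
  have "(P *v x) \<bullet> (P *v y) = (x v* transpose P) \<bullet> (P *v y)"
    using transpose_matrix_vector[of "transpose P" x] by simp
  also have "\<dots> = x \<bullet> ((transpose P ** P) *v y)"
    by (simp only: dot_lmul_matrix matrix_vector_mul_assoc)
  finally have "(P *v x) \<bullet> (P *v y) = x \<bullet> y" by (simp add: PP)
  moreover have "(P *v z) $ i = z \<bullet> e i" for z i
    by (simp add: P_def matrix_vector_mult_def inner_vec_def mult.commute)
  ultimately show ?thesis by (simp add: inner_vec_def[of "P *v x"])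
qed

text \<open>
  An orthonormal set of eigenvectors of maximal cardinality spans the space: otherwise its
  orthogonal complement, which is invariant by symmetry, contains a further eigenvector.
\<close>

lemma symmetric_eigenframe:
  fixes H :: "real ^ 'n ^ 'n::finite"
  assumes "transpose H = H"
  obtains b \<mu> where "orthonormal_frame b" "\<And>i. H *v b i = \<mu> i *\<^sub>R b i"
proof -
  let ?good = "\<lambda>B. pairwise orthogonal B \<and> (\<forall>b\<in>B. norm b = 1 \<and> (\<exists>m. H *v b = m *\<^sub>R b))"
  have adj: "(H *v x) \<bullet> y = x \<bullet> (H *v y)" for x y
    using assms dot_lmul_matrix[of x H y] by (metis transpose_matrix_vector dot_lmul_matrix)
  have ind: "independent B" if "?good B" for B
    using that by (intro pairwise_orthogonal_independent) auto
  have "\<exists>B. ?good B \<and> (\<forall>B'. ?good B' \<longrightarrow> card B' \<le> card B)"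
  proof (rule ex_has_greatest_nat[where P = ?good and f = card and k = "{}" and b = "Suc (CARD('n))"])
    show "\<forall>B. ?good B \<longrightarrow> card B < Suc CARD('n)"
      using ind independent_card_le by fastforce
  qed auto
  then obtain B where B: "?good B" and max: "\<And>B'. ?good B' \<Longrightarrow> card B' \<le> card B" by blast
  have fin: "finite B" using ind[OF B] by (simp add: independent_imp_finite)
  define S where "S = {y. \<forall>b\<in>B. b \<bullet> y = 0}"
  have "span B = UNIV"
  proof (rule ccontr)
    assume "span B \<noteq> UNIV"
    then obtain y where y: "y \<noteq> 0" "\<forall>b\<in>span B. y \<bullet> b = 0"
      using span_not_UNIV_orthogonal by blast
    have "\<exists>x\<in>S. norm x = 1 \<and> (\<exists>m. H *v x = m *\<^sub>R x)"
    proof (rule selfadjoint_eigenvector[where y = y])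
      show "subspace S" by (auto simp: S_def subspace_def inner_add_right)
      show "y \<in> S" using y by (auto simp: S_def span_base inner_commute)
      show "H *v x \<in> S" if "x \<in> S" for x
        unfolding S_def
      proof safe
        fix b assume b: "b \<in> B"
        then obtain m where "H *v b = m *\<^sub>R b" using B by blast
        then show "b \<bullet> (H *v x) = 0" using that b by (simp add: adj[symmetric] S_def)
      qed
      show "linear ((*v) H)" by (rule matrix_vector_mul_linear)
      show "(H *v x) \<bullet> z = x \<bullet> (H *v z)" for x z by (rule adj)
      show "y \<noteq> 0" by (rule y(1))
    qed
    then obtain x where x: "x \<in> S" "norm x = 1" "\<exists>m. H *v x = m *\<^sub>R x" by blast
    have "x \<notin> B" using x by (auto simp: S_def)
    moreover have "?good (insert x B)"
      using B x by (auto simp: pairwise_insert S_def orthogonal_def inner_commute)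
    ultimately show False using max[of "insert x B"] fin by simp
  qed
  then have "card B = CARD('n)"
    using dim_span_eq_card_independent[OF ind[OF B]] by (simp add: dim_UNIV)
  then obtain b where b: "bij_betw b (UNIV :: 'n set) B"
    using fin finite_same_card_bij[of "UNIV :: 'n set" B] by auto
  have bB: "b i \<in> B" for i using b by (auto simp: bij_betw_def)
  have "orthonormal_frame b"
    unfolding orthonormal_frame_def
  proof (intro allI)
    fix i j
    show "b i \<bullet> b j = (if i = j then 1 else 0)"
    proof (cases "i = j")
      case True then show ?thesis using B bB by (simp add: norm_eq_1)
    next
      case False
      then have "b i \<noteq> b j" using b by (auto simp: bij_betw_def inj_on_def)
      then show ?thesis using B bB False by (auto simp: pairwise_def orthogonal_def)
    qed
  qed
  moreover have "\<forall>i. \<exists>m. H *v b i = m *\<^sub>R b i"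
    using B bB by blast
  then obtain \<mu> where "\<And>i. H *v b i = \<mu> i *\<^sub>R b i"
    by (auto simp: choice_iff)
  ultimately show ?thesis using that by blast
qed

text \<open>
  The matrix on the left is \<open>P L P\<^sup>T\<close> with \<open>P\<close> the image of an orthogonal matrix and \<open>L\<close>
  diagonal. Stating this for a ring homomorphism \<open>\<phi>\<close> covers both the characteristic polynomial
  and the complex matrix \<open>c I + \<i> H\<close>.
\<close>

lemma det_shifted_conjugate:
  fixes Q :: "'n::finite \<Rightarrow> 'n \<Rightarrow> real" and \<phi> :: "real \<Rightarrow> 'a::comm_ring_1"
  assumes Q: "\<And>j k. (\<Sum>i\<in>UNIV. Q j i * Q k i) = (if j = k then 1 else 0)"
    and hom: "\<phi> 0 = 0" "\<phi> 1 = 1" "\<And>x y. \<phi> (x + y) = \<phi> x + \<phi> y" "\<And>x y. \<phi> (x * y) = \<phi> x * \<phi> y"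
  shows "det (\<chi> j k. (if j = k then z else 0) + s * \<phi> (\<Sum>i\<in>UNIV. Q j i * \<mu> i * Q k i))
    = (\<Prod>i\<in>UNIV. z + s * \<phi> (\<mu> i))"
proof -
  have hsum: "\<phi> (sum g A) = (\<Sum>i\<in>A. \<phi> (g i))" for g :: "'n \<Rightarrow> real" and A
    by (induction A rule: infinite_finite_induct) (auto simp: hom)
  define P where "P = (\<chi> j i. \<phi> (Q j i))"
  define L where "L = (\<chi> i j. if i = j then z + s * \<phi> (\<mu> i) else 0)"
  have \<delta>: "(\<Sum>i\<in>UNIV. \<phi> (Q j i) * \<phi> (Q k i)) = (if j = k then 1 else 0)" for j k
    using arg_cong[OF Q[of j k], of \<phi>] by (auto simp: hsum hom split: if_splits)
  have PP: "P ** transpose P = mat 1"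
    by (simp add: vec_eq_iff P_def matrix_matrix_mult_def transpose_def mat_def \<delta>)
  have PL: "P ** L = (\<chi> j i. \<phi> (Q j i) * (z + s * \<phi> (\<mu> i)))"
    by (simp add: vec_eq_iff P_def L_def matrix_matrix_mult_def if_distrib cong: if_cong)
  have "(\<chi> j k. (if j = k then z else 0) + s * \<phi> (\<Sum>i\<in>UNIV. Q j i * \<mu> i * Q k i))
      = P ** L ** transpose P"
  proof -
    have "(if j = k then z else 0) + s * \<phi> (\<Sum>i\<in>UNIV. Q j i * \<mu> i * Q k i)
      = (\<Sum>i\<in>UNIV. \<phi> (Q j i) * (z + s * \<phi> (\<mu> i)) * \<phi> (Q k i))" for j k
    proof -
      have "(\<Sum>i\<in>UNIV. \<phi> (Q j i) * (z + s * \<phi> (\<mu> i)) * \<phi> (Q k i))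
        = z * (\<Sum>i\<in>UNIV. \<phi> (Q j i) * \<phi> (Q k i))
          + s * (\<Sum>i\<in>UNIV. \<phi> (Q j i) * \<phi> (\<mu> i) * \<phi> (Q k i))"
        unfolding sum_distrib_left sum.distrib[symmetric]
        by (intro sum.cong) (auto simp: algebra_simps)
      then show ?thesis by (simp add: \<delta> hsum hom)
    qed
    then show ?thesis
      unfolding PL by (simp add: vec_eq_iff P_def matrix_matrix_mult_def transpose_def)
  qed
  then have "det (\<chi> j k. (if j = k then z else 0) + s * \<phi> (\<Sum>i\<in>UNIV. Q j i * \<mu> i * Q k i))
      = det L * (det P * det (transpose P))"
    by (simp add: det_mul)
  also have "\<dots> = det L"
    using PP by (metis det_mul det_I mult.right_neutral)
  also have "\<dots> = (\<Prod>i\<in>UNIV. z + s * \<phi> (\<mu> i))"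
    by (subst det_diagonal) (auto simp: L_def)
  finally show ?thesis .
qed

lemma frame_matrix_entry:
  fixes H :: "real ^ 'n ^ 'n::finite"
  assumes b: "orthonormal_frame b" and eig: "\<And>i. H *v b i = \<mu> i *\<^sub>R b i" and sym: "transpose H = H"
  shows "x \<bullet> (H *v y) = (\<Sum>i\<in>UNIV. (x \<bullet> b i) * \<mu> i * (y \<bullet> b i))"
proof -
  have "(H *v y) \<bullet> b i = \<mu> i * (y \<bullet> b i)" for i
    using sym eig[of i] by (metis dot_lmul_matrix inner_scaleR_right transpose_matrix_vector)
  then show ?thesis
    by (subst orthonormal_frame_inner[OF b]) (simp add: mult_ac)
qed

text \<open>
  Links the sorted list of roots of the characteristic polynomial to any eigenframe. A sum over
  all eigenvalues does not see the order of the list.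
\<close>

lemma sum_eigenvalues:
  fixes H :: "real ^ 'n ^ 'n::finite" and g :: "real \<Rightarrow> real"
  assumes b: "orthonormal_frame b" and eig: "\<And>i. H *v b i = \<mu> i *\<^sub>R b i" and sym: "transpose H = H"
  shows "(\<Sum>i<CARD('n). g (eigenvalues H ! i)) = (\<Sum>i\<in>UNIV. g (\<mu> i))"
proof -
  have Q: "(\<Sum>i\<in>UNIV. b i $ j * b i $ k) = (if j = k then 1 else 0)" for j k
    using orthonormal_frame_inner[OF b, of "axis j 1" "axis k 1", symmetric]
    unfolding inner_axis_axis by (simp add: inner_axis')
  have H: "H $ j $ k = (\<Sum>i\<in>UNIV. b i $ j * \<mu> i * b i $ k)" for j k
    using frame_matrix_entry[OF b eig sym, of "axis j 1" "axis k 1"]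
    by (simp add: inner_axis' matrix_vector_mult_basis column_def)
  have "charpoly H = det (\<chi> j k. (if j = k then [:0, 1:] else 0) + (- 1) *
      [:\<Sum>i\<in>UNIV. b i $ j * \<mu> i * b i $ k:])"
    unfolding charpoly_def by (rule arg_cong[where f = det]) (simp add: vec_eq_iff mat_def H)
  also have "\<dots> = (\<Prod>i\<in>UNIV. [:0, 1:] + (- 1) * [:\<mu> i:])"
    by (rule det_shifted_conjugate) (auto simp: Q)
  also have "\<dots> = (\<Prod>i\<in>UNIV. [:- \<mu> i, 1:])" by simp
  finally have cp: "charpoly H = (\<Prod>i\<in>UNIV. [:- \<mu> i, 1:])" .
  have pr: "proots (charpoly H) = image_mset \<mu> (mset_set UNIV)"
    unfolding cp by (subst proots_prod) (auto simp: sum_unfold_sum_mset)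
  have ms: "mset (eigenvalues H) = image_mset \<mu> (mset_set UNIV)"
    by (simp add: eigenvalues_def pr)
  then have len: "length (eigenvalues H) = CARD('n)"
    by (metis size_mset size_image_mset size_mset_set)
  have "(\<Sum>i<CARD('n). g (eigenvalues H ! i)) = sum_list (map g (eigenvalues H))"
    by (simp add: sum_list_sum_nth len atLeast0LessThan)
  also have "\<dots> = sum_mset (image_mset g (mset (eigenvalues H)))"
    by (metis mset_map sum_mset_sum_list)
  also have "\<dots> = (\<Sum>i\<in>UNIV. g (\<mu> i))"
    by (simp add: ms image_mset.compositionality comp_def sum_unfold_sum_mset)
  finally show ?thesis .
qed

section \<open>Directional derivatives of smooth functions\<close>

definition dir_deriv :: "'a::euclidean_space \<Rightarrow> ('a \<Rightarrow> real) \<Rightarrow> 'a \<Rightarrow> real" where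
  "dir_deriv v f x = frechet_derivative f (at x) v"

lemma smooth_on_dir_deriv:
  assumes "smooth_on f S" shows "smooth_on (dir_deriv v f) S"
  unfolding smooth_on_def
proof
  fix k
  have "Ck_on (Suc k) f S" using assms by (simp only: smooth_on_def)
  then show "Ck_on k (dir_deriv v f) S" by (simp add: dir_deriv_def[abs_def])
qed

lemma smooth_on_has_derivative:
  assumes "smooth_on f S" "x \<in> S"
  shows "(f has_derivative (\<lambda>v. dir_deriv v f x)) (at x)"
proof -
  have "Ck_on (Suc 0) f S" using assms(1) by (simp only: smooth_on_def)
  then have "f differentiable (at x)" using assms(2) by simp
  then show ?thesis by (simp add: dir_deriv_def frechet_derivative_works[symmetric])
qed

lemma smooth_on_continuous_on:
  assumes "smooth_on f S" shows "continuous_on S f"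
proof -
  have "Ck_on 0 f S" using assms by (simp only: smooth_on_def)
  then show ?thesis by simp
qed

lemma dir_deriv_eqI:
  assumes "(f has_derivative f') (at x)" shows "dir_deriv v f x = f' v"
  using frechet_derivative_at[OF assms] by (simp add: dir_deriv_def)

lemma dir_deriv_cong:
  assumes "open S" "x \<in> S" "\<And>y. y \<in> S \<Longrightarrow> f y = g y" "smooth_on f S"
  shows "dir_deriv v f x = dir_deriv v g x"
proof -
  have "(g has_derivative (\<lambda>v. dir_deriv v f x)) (at x)"
    using has_derivative_transform_within_open[OF smooth_on_has_derivative[OF assms(4,2)] assms(1,2)]
      assms(3) by blast
  then show ?thesis using dir_deriv_eqI by metis
qed

lemma dir_deriv_line:
  assumes "smooth_on f S" "x + t *\<^sub>R v \<in> S"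
  shows "((\<lambda>s. f (x + s *\<^sub>R v)) has_real_derivative dir_deriv v f (x + t *\<^sub>R v)) (at t)"
proof -
  have d: "(f has_derivative (\<lambda>w. dir_deriv w f (x + t *\<^sub>R v))) (at (x + t *\<^sub>R v))"
    using smooth_on_has_derivative[OF assms] .
  then have lin: "linear (\<lambda>w. dir_deriv w f (x + t *\<^sub>R v))" by (rule has_derivative_linear)
  have "((\<lambda>s. x + s *\<^sub>R v) has_derivative (\<lambda>s. s *\<^sub>R v)) (at t)"
    by (auto intro!: derivative_eq_intros)
  then have "((\<lambda>s. f (x + s *\<^sub>R v)) has_derivative
      (\<lambda>s. dir_deriv (s *\<^sub>R v) f (x + t *\<^sub>R v))) (at t)"
    using d by (rule has_derivative_compose)
  also have "(\<lambda>s. dir_deriv (s *\<^sub>R v) f (x + t *\<^sub>R v)) = (*) (dir_deriv v f (x + t *\<^sub>R v))"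
    using linear_scale[OF lin, of _ v] by (simp add: fun_eq_iff mult.commute)
  finally show ?thesis by (simp add: has_field_derivative_def)
qed

lemma dir_deriv_sum:
  assumes "smooth_on f S" "x \<in> S"
  shows "dir_deriv (\<Sum>i\<in>I. c i *\<^sub>R v i) f x = (\<Sum>i\<in>I. c i * dir_deriv (v i) f x)"
proof -
  have "linear (\<lambda>w. dir_deriv w f x)"
    using smooth_on_has_derivative[OF assms] by (rule has_derivative_linear)
  from linear_sum[OF this, of "\<lambda>i. c i *\<^sub>R v i" I] linear_scale[OF this]
  show ?thesis by simp
qed

text \<open>
  Two applications of the mean value theorem, the first in direction \<open>v\<close> and the second in
  direction \<open>w\<close>. The left hand side is symmetric in \<open>v\<close> and \<open>w\<close>, so second derivatives commute
  in the limit \<open>h \<longlonglongrightarrow> 0\<close>.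
\<close>

lemma second_difference_mean_value:
  assumes f: "smooth_on f S" and h: "h > 0"
    and S: "\<And>s r. 0 \<le> s \<Longrightarrow> s \<le> h \<Longrightarrow> 0 \<le> r \<Longrightarrow> r \<le> h \<Longrightarrow> x + s *\<^sub>R v + r *\<^sub>R w \<in> S"
  shows "\<exists>s r. 0 < s \<and> s < h \<and> 0 < r \<and> r < h \<and>
    f (x + h *\<^sub>R v + h *\<^sub>R w) - f (x + h *\<^sub>R v) - f (x + h *\<^sub>R w) + f x
      = h\<^sup>2 * dir_deriv w (dir_deriv v f) (x + s *\<^sub>R v + r *\<^sub>R w)"
proof -
  let ?g = "\<lambda>s. f (x + h *\<^sub>R w + s *\<^sub>R v) - f (x + s *\<^sub>R v)"
  have "\<exists>s>0. s < h \<and> ?g h - ?g 0 = (h - 0) *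
      (dir_deriv v f (x + h *\<^sub>R w + s *\<^sub>R v) - dir_deriv v f (x + s *\<^sub>R v))"
  proof (rule MVT2[OF h])
    fix s assume "0 \<le> s" "s \<le> h"
    then show "(?g has_real_derivative
        dir_deriv v f (x + h *\<^sub>R w + s *\<^sub>R v) - dir_deriv v f (x + s *\<^sub>R v)) (at s)"
      using S[of s h] S[of s 0] h
      by (intro DERIV_diff dir_deriv_line[OF f]) (auto simp: algebra_simps)
  qed
  then obtain s where s: "0 < s" "s < h" "?g h - ?g 0 = h *
      (dir_deriv v f (x + s *\<^sub>R v + h *\<^sub>R w) - dir_deriv v f (x + s *\<^sub>R v))"
    by (auto simp: algebra_simps)
  let ?k = "\<lambda>r. dir_deriv v f (x + s *\<^sub>R v + r *\<^sub>R w)"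
  have "\<exists>r>0. r < h \<and> ?k h - ?k 0 =
      (h - 0) * dir_deriv w (dir_deriv v f) (x + s *\<^sub>R v + r *\<^sub>R w)"
    by (rule MVT2[OF h]) (use S s in \<open>auto intro!: dir_deriv_line[OF smooth_on_dir_deriv[OF f]]\<close>)
  then obtain r where r: "0 < r" "r < h" "?k h - ?k 0 =
      h * dir_deriv w (dir_deriv v f) (x + s *\<^sub>R v + r *\<^sub>R w)"
    by auto
  have "f (x + h *\<^sub>R v + h *\<^sub>R w) - f (x + h *\<^sub>R v) - f (x + h *\<^sub>R w) + f x = ?g h - ?g 0"
    by (simp add: algebra_simps)
  also have "\<dots> = h * (?k h - ?k 0)" unfolding s(3) by simp
  also have "\<dots> = h\<^sup>2 * dir_deriv w (dir_deriv v f) (x + s *\<^sub>R v + r *\<^sub>R w)"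
    unfolding r(3) by (simp add: power2_eq_square)
  finally show ?thesis using s r by blast
qed

lemma dir_deriv_commute:
  assumes S: "open S" "x \<in> S" and f: "smooth_on f S"
  shows "dir_deriv v (dir_deriv w f) x = dir_deriv w (dir_deriv v f) x"
proof -
  define A where "A = dir_deriv v (dir_deriv w f)"
  define B where "B = dir_deriv w (dir_deriv v f)"
  have sm: "smooth_on A S" "smooth_on B S"
    unfolding A_def B_def by (intro smooth_on_dir_deriv f)+
  have cont: "isCont A x" "isCont B x"
    using sm[THEN smooth_on_continuous_on] S by (auto simp: continuous_on_eq_continuous_at)
  have close: "dist (A x) (B x) < \<epsilon>" if \<epsilon>: "\<epsilon> > 0" for \<epsilon>
  proof -
    have "\<exists>d>0. \<forall>y. dist y x < d \<longrightarrow> dist (A y) (A x) < \<epsilon> / 2"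
      using cont(1)[unfolded continuous_at_eps_delta, rule_format, of "\<epsilon> / 2"] \<epsilon> by simp
    then obtain d1 where d1: "d1 > 0" "\<And>y. dist y x < d1 \<Longrightarrow> dist (A y) (A x) < \<epsilon> / 2"
      by blast
    have "\<exists>d>0. \<forall>y. dist y x < d \<longrightarrow> dist (B y) (B x) < \<epsilon> / 2"
      using cont(2)[unfolded continuous_at_eps_delta, rule_format, of "\<epsilon> / 2"] \<epsilon> by simp
    then obtain d2 where d2: "d2 > 0" "\<And>y. dist y x < d2 \<Longrightarrow> dist (B y) (B x) < \<epsilon> / 2"
      by blast
    obtain d3 where d3: "d3 > 0" "ball x d3 \<subseteq> S"
      using openE[OF S] by blast
    define d where "d = min d1 (min d2 d3)"
    define h where "h = d / (norm v + norm w + 1)"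
    have d: "d > 0" and d_le: "d \<le> d1" "d \<le> d2" "d \<le> d3"
      using d1(1) d2(1) d3(1) by (simp_all add: d_def)
    have pos: "norm v + norm w + 1 > 0" by (simp add: add_nonneg_pos)
    have h: "h > 0" using d pos by (simp add: h_def)
    have near: "dist (x + s *\<^sub>R v + r *\<^sub>R w) x < d" if "0 \<le> s" "s \<le> h" "0 \<le> r" "r \<le> h" for s r
    proof -
      have "dist (x + s *\<^sub>R v + r *\<^sub>R w) x = norm (s *\<^sub>R v + r *\<^sub>R w)" by (simp add: dist_norm)
      also have "\<dots> \<le> s * norm v + r * norm w"
        using that norm_triangle_ineq[of "s *\<^sub>R v" "r *\<^sub>R w"] by simp
      also have "\<dots> \<le> h * norm v + h * norm w"
        using that by (intro add_mono mult_right_mono) auto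
      also have "\<dots> < h * (norm v + norm w + 1)" using h by (simp add: algebra_simps)
      also have "\<dots> = d" using pos by (simp add: h_def)
      finally show ?thesis .
    qed
    have inS: "x + s *\<^sub>R v + r *\<^sub>R w \<in> S" if "0 \<le> s" "s \<le> h" "0 \<le> r" "r \<le> h" for s r
    proof (rule subsetD[OF d3(2)])
      show "x + s *\<^sub>R v + r *\<^sub>R w \<in> ball x d3"
        using less_le_trans[OF near[OF that] d_le(3)] unfolding mem_ball by (subst dist_commute)
    qed
    obtain s r where 1: "0 < s" "s < h" "0 < r" "r < h"
      "f (x + h *\<^sub>R v + h *\<^sub>R w) - f (x + h *\<^sub>R v) - f (x + h *\<^sub>R w) + f x
        = h\<^sup>2 * B (x + s *\<^sub>R v + r *\<^sub>R w)"
      unfolding B_def using second_difference_mean_value[OF f h, of x v w] inS by blast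
    have inS': "x + s *\<^sub>R w + r *\<^sub>R v \<in> S" if "0 \<le> s" "s \<le> h" "0 \<le> r" "r \<le> h" for s r
      using inS[of r s] that by (simp add: algebra_simps)
    obtain s' r' where 2: "0 < s'" "s' < h" "0 < r'" "r' < h"
      "f (x + h *\<^sub>R w + h *\<^sub>R v) - f (x + h *\<^sub>R w) - f (x + h *\<^sub>R v) + f x
        = h\<^sup>2 * A (x + s' *\<^sub>R w + r' *\<^sub>R v)"
      unfolding A_def using second_difference_mean_value[OF f h, of x w v] inS' by blast
    have corner: "x + h *\<^sub>R w + h *\<^sub>R v = x + h *\<^sub>R v + h *\<^sub>R w"
      and swap: "x + s' *\<^sub>R w + r' *\<^sub>R v = x + r' *\<^sub>R v + s' *\<^sub>R w"
      by simp_all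
    have "h\<^sup>2 * A (x + r' *\<^sub>R v + s' *\<^sub>R w) = h\<^sup>2 * B (x + s *\<^sub>R v + r *\<^sub>R w)"
      using 1(5) 2(5) unfolding corner swap by linarith
    then have "A (x + r' *\<^sub>R v + s' *\<^sub>R w) = B (x + s *\<^sub>R v + r *\<^sub>R w)"
      using h by simp
    moreover have "dist (A (x + r' *\<^sub>R v + s' *\<^sub>R w)) (A x) < \<epsilon> / 2"
    proof (rule d1(2))
      show "dist (x + r' *\<^sub>R v + s' *\<^sub>R w) x < d1"
        by (rule less_le_trans[OF near[OF 2(3,4,1,2)[THEN less_imp_le]] d_le(1)])
    qed
    moreover have "dist (B (x + s *\<^sub>R v + r *\<^sub>R w)) (B x) < \<epsilon> / 2"
    proof (rule d2(2))
      show "dist (x + s *\<^sub>R v + r *\<^sub>R w) x < d2"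
        by (rule less_le_trans[OF near[OF 1(1-4)[THEN less_imp_le]] d_le(2)])
    qed
    ultimately show "dist (A x) (B x) < \<epsilon>"
      using dist_triangle_half_r[of "B (x + s *\<^sub>R v + r *\<^sub>R w)" "A x" \<epsilon> "B x"] by simp
  qed
  have "A x = B x"
    using close[of "dist (A x) (B x)"] zero_less_dist_iff[of "A x" "B x"] by blast
  then show ?thesis unfolding A_def B_def .
qed


lemma partial_deriv_eq_dir_deriv: "partial_deriv i = dir_deriv (axis i 1)"
  by (simp add: fun_eq_iff partial_deriv_def dir_deriv_def)

lemma dir_deriv_eq_sum_partial:
  fixes f :: "real ^ 'n::finite \<Rightarrow> real"
  assumes "smooth_on f S" "x \<in> S"
  shows "dir_deriv v f x = (\<Sum>i\<in>UNIV. v $ i * partial_deriv i f x)"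
  using dir_deriv_sum[OF assms, of "\<lambda>i. v $ i" "\<lambda>i. axis i 1" UNIV] basis_expansion[of v]
  by (simp add: partial_deriv_eq_dir_deriv scalar_mult_eq_scaleR)

lemma dir_deriv_eq_grad:
  fixes f :: "real ^ 'n::finite \<Rightarrow> real"
  assumes "smooth_on f S" "x \<in> S"
  shows "dir_deriv v f x = grad f x \<bullet> v"
  by (simp add: dir_deriv_eq_sum_partial[OF assms] grad_def inner_vec_def mult.commute)

lemma continuous_on_grad:
  fixes f :: "real ^ 'n::finite \<Rightarrow> real"
  assumes "smooth_on f S" shows "continuous_on S (grad f)"
  unfolding grad_def[abs_def] partial_deriv_eq_dir_deriv
  by (intro continuous_on_vec_lambda smooth_on_continuous_on smooth_on_dir_deriv assms)

lemma dir_deriv_dir_deriv_eq_hessian: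
  fixes f :: "real ^ 'n::finite \<Rightarrow> real"
  assumes f: "smooth_on f S" and S: "open S" "x \<in> S"
  shows "dir_deriv v (dir_deriv w f) x = v \<bullet> (hessian f x *v w)"
proof -
  have "((\<lambda>y. \<Sum>k\<in>UNIV. w $ k * partial_deriv k f y) has_derivative
      (\<lambda>v. \<Sum>k\<in>UNIV. w $ k * dir_deriv v (partial_deriv k f) x)) (at x)"
    unfolding partial_deriv_eq_dir_deriv
    by (intro has_derivative_sum has_derivative_mult_right
        smooth_on_has_derivative[OF smooth_on_dir_deriv[OF f] S(2)])
  then have "dir_deriv v (\<lambda>y. \<Sum>k\<in>UNIV. w $ k * partial_deriv k f y) x
      = (\<Sum>k\<in>UNIV. w $ k * dir_deriv v (partial_deriv k f) x)"
    by (rule dir_deriv_eqI)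
  moreover have "dir_deriv v (dir_deriv w f) x
      = dir_deriv v (\<lambda>y. \<Sum>k\<in>UNIV. w $ k * partial_deriv k f y) x"
    by (rule dir_deriv_cong[OF S dir_deriv_eq_sum_partial[OF f] smooth_on_dir_deriv[OF f]])
  moreover have "dir_deriv v (partial_deriv k f) x = (\<Sum>j\<in>UNIV. v $ j * hessian f x $ j $ k)" for k
    using dir_deriv_eq_sum_partial[OF smooth_on_dir_deriv[OF f] S(2), of v "axis k 1"]
    by (simp add: hessian_def partial_deriv_eq_dir_deriv[of k])
  ultimately have "dir_deriv v (dir_deriv w f) x
      = (\<Sum>k\<in>UNIV. \<Sum>j\<in>UNIV. w $ k * (v $ j * hessian f x $ j $ k))"
    by (simp add: sum_distrib_left)
  also have "\<dots> = (\<Sum>j\<in>UNIV. \<Sum>k\<in>UNIV. w $ k * (v $ j * hessian f x $ j $ k))"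
    by (rule sum.swap)
  also have "\<dots> = v \<bullet> (hessian f x *v w)"
    by (simp add: inner_vec_def matrix_vector_mult_def sum_distrib_left mult_ac)
  finally show ?thesis .
qed

lemma transpose_hessian:
  fixes f :: "real ^ 'n::finite \<Rightarrow> real"
  assumes f: "smooth_on f S" and S: "open S" "x \<in> S"
  shows "transpose (hessian f x) = hessian f x"
  using dir_deriv_commute[OF S f]
  by (simp add: vec_eq_iff transpose_def hessian_def partial_deriv_eq_dir_deriv)

lemma Ck_on_cong:
  assumes S: "open S" and f: "Ck_on k f S" and eq: "\<And>x. x \<in> S \<Longrightarrow> f x = g x"
  shows "Ck_on k g S"
  using f eq
proof (induction k arbitrary: f g)
  case 0
  then show ?case using continuous_on_cong[OF refl, of S f g] by simp
next
  case (Suc k)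
  have g: "(g has_derivative frechet_derivative f (at x)) (at x)" if x: "x \<in> S" for x
  proof (rule has_derivative_transform_within_open[OF _ S x])
    show "(f has_derivative frechet_derivative f (at x)) (at x)"
      using Suc.prems(1) x by (simp add: frechet_derivative_works[symmetric])
  qed (use Suc.prems in simp)
  have "Ck_on k (\<lambda>x. frechet_derivative g (at x) v) S" for v
  proof (rule Suc.IH)
    show "Ck_on k (\<lambda>x. frechet_derivative f (at x) v) S" using Suc.prems(1) by simp
    show "frechet_derivative f (at x) v = frechet_derivative g (at x) v" if "x \<in> S" for x
      using frechet_derivative_at[OF g[OF that]] by simp
  qed
  moreover have "g differentiable (at x)" if "x \<in> S" for x
    using g[OF that] by (rule differentiableI)
  ultimately show ?case by simp
qed

lemma Ck_on_minus:
  assumes S: "open S" and f: "Ck_on k f S"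
  shows "Ck_on k (\<lambda>x. - f x) S"
  using f
proof (induction k arbitrary: f)
  case 0
  then show ?case by (simp add: continuous_on_minus)
next
  case (Suc k)
  have m: "((\<lambda>x. - f x) has_derivative (\<lambda>v. - frechet_derivative f (at x) v)) (at x)" if "x \<in> S" for x
    using Suc.prems that by (intro has_derivative_minus) (simp add: frechet_derivative_works[symmetric])
  have "Ck_on k (\<lambda>x. frechet_derivative (\<lambda>x. - f x) (at x) v) S" for v
  proof (rule Ck_on_cong[OF S])
    show "Ck_on k (\<lambda>x. - frechet_derivative f (at x) v) S"
      using Suc.prems by (intro Suc.IH) simp
    show "- frechet_derivative f (at x) v = frechet_derivative (\<lambda>x. - f x) (at x) v" if "x \<in> S" for x
      by (simp add: frechet_derivative_at[OF m[OF that], symmetric])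
  qed
  moreover have "(\<lambda>x. - f x) differentiable (at x)" if "x \<in> S" for x
    using m[OF that] by (rule differentiableI)
  ultimately show ?case by simp
qed

lemma smooth_on_minus:
  assumes "open S" "smooth_on f S"
  shows "smooth_on (\<lambda>x. - f x) S"
  using assms Ck_on_minus unfolding smooth_on_def by blast

lemma dir_deriv_minus:
  assumes "smooth_on f S" "x \<in> S"
  shows "dir_deriv v (\<lambda>x. - f x) x = - dir_deriv v f x"
  by (rule dir_deriv_eqI[OF has_derivative_minus[OF smooth_on_has_derivative[OF assms]]])

lemma hessian_minus:
  fixes u :: "real ^ 'n::finite \<Rightarrow> real"
  assumes S: "open S" "x \<in> S" and u: "smooth_on u S"
  shows "hessian (\<lambda>x. - u x) x = - hessian u x"
proof -
  have "dir_deriv v (dir_deriv w (\<lambda>x. - u x)) x = - dir_deriv v (dir_deriv w u) x" for v w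
  proof -
    have "dir_deriv v (dir_deriv w (\<lambda>x. - u x)) x = dir_deriv v (\<lambda>y. - dir_deriv w u y) x"
      by (rule dir_deriv_cong[OF S dir_deriv_minus[OF u]
          smooth_on_dir_deriv[OF smooth_on_minus[OF S(1) u]]])
    also have "\<dots> = - dir_deriv v (dir_deriv w u) x"
      by (rule dir_deriv_minus[OF smooth_on_dir_deriv[OF u] S(2)])
    finally show ?thesis .
  qed
  then show ?thesis by (simp add: vec_eq_iff hessian_def partial_deriv_eq_dir_deriv)
qed

section \<open>The equation as a condition on a complex determinant\<close>

text \<open>
  In the Leibniz expansion, a permutation other than the identity moves at least two indices.
  Its product therefore has at least two factors vanishing at \<open>t\<close>, and its derivative is zero.
\<close>

lemma det_has_vector_derivative_at_diagonal:
  fixes M :: "real \<Rightarrow> complex ^ 'n ^ 'n::finite"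
  assumes M: "\<And>i j. ((\<lambda>t. M t $ i $ j) has_vector_derivative M' i j) (at t)"
    and diag: "\<And>i j. i \<noteq> j \<Longrightarrow> M t $ i $ j = 0"
  shows "((\<lambda>t. det (M t)) has_vector_derivative
    (\<Sum>i\<in>UNIV. M' i i * (\<Prod>j\<in>UNIV - {i}. M t $ j $ j))) (at t)"
proof -
  let ?P = "{p. p permutes (UNIV :: 'n set)}"
  let ?D = "\<lambda>p. \<Sum>i\<in>UNIV. M' i (p i) * (\<Prod>j\<in>UNIV - {i}. M t $ j $ p j)"
  have off: "?D p = 0" if p: "p \<in> ?P" "p \<noteq> id" for p
  proof (rule sum.neutral, rule ballI)
    fix i
    obtain a where a: "p a \<noteq> a" using p(2) by (metis eq_id_iff)
    have "p (p a) \<noteq> p a" using a p(1) permutes_inj[of p] by (auto dest: injD)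
    then obtain j where "j \<noteq> i" "p j \<noteq> j" using a by metis
    then have "(\<Prod>j\<in>UNIV - {i}. M t $ j $ p j) = 0"
      using diag[of j "p j"] by (auto intro!: prod_zero)
    then show "M' i (p i) * (\<Prod>j\<in>UNIV - {i}. M t $ j $ p j) = 0" by simp
  qed
  have "((\<lambda>s. \<Prod>i\<in>UNIV. M s $ i $ p i) has_vector_derivative ?D p) (at t)" for p
  proof -
    have "((\<lambda>s. \<Prod>i\<in>UNIV. M s $ i $ p i) has_derivative
        (\<lambda>h. \<Sum>i\<in>UNIV. (h *\<^sub>R M' i (p i)) * (\<Prod>j\<in>UNIV - {i}. M t $ j $ p j))) (at t)"
      using M by (intro has_derivative_prod) (auto simp: has_vector_derivative_def)
    then show ?thesis
      by (simp add: has_vector_derivative_def scaleR_sum_right mult_ac)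
  qed
  then have "((\<lambda>s. det (M s)) has_vector_derivative
      (\<Sum>p\<in>?P. of_int (sign p) * ?D p)) (at t)"
    unfolding det_def by (intro has_vector_derivative_sum has_vector_derivative_mult_right) auto
  also have "(\<Sum>p\<in>?P. of_int (sign p) * ?D p) = (\<Sum>p\<in>{id}. of_int (sign p) * ?D p)"
    using off by (intro sum.mono_neutral_right) (auto simp: finite_permutations permutes_id)
  finally show ?thesis by simp
qed

lemma prod_eq_polar_sum_arctan:
  fixes \<mu> :: "'n::finite \<Rightarrow> real"
  assumes "c > 0"
  shows "\<exists>r>0. (\<Prod>i\<in>UNIV. complex_of_real c + \<i> * complex_of_real (\<mu> i))
    = complex_of_real r * cis (\<Sum>i\<in>UNIV. arctan (\<mu> i / c))"
proof -
  have one: "complex_of_real c + \<i> * complex_of_real m = complex_of_real (c * sqrt (1 + (m / c)\<^sup>2)) * cis (arctan (m / c))" for m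
  proof -
    have "sqrt (1 + (m / c)\<^sup>2) > 0" by (simp add: add_pos_nonneg)
    then show ?thesis using assms by (simp add: complex_eq_iff cos_arctan sin_arctan)
  qed
  have "(\<Prod>i\<in>I. complex_of_real c + \<i> * complex_of_real (\<mu> i))
    = complex_of_real (\<Prod>i\<in>I. c * sqrt (1 + (\<mu> i / c)\<^sup>2)) * cis (\<Sum>i\<in>I. arctan (\<mu> i / c))" if "finite I" for I
    using that by (induction I rule: finite_induct) (auto simp: one cis_mult[symmetric])
  moreover have "(\<Prod>i\<in>UNIV. c * sqrt (1 + (\<mu> i / c)\<^sup>2)) > 0"
    using assms by (intro prod_pos) (auto intro!: mult_pos_pos add_pos_nonneg)
  ultimately show ?thesis by (metis finite)
qed


text \<open>
  In an eigenframe the determinant is \<open>\<Prod>\<^sub>i (c + \<i> \<mu>\<^sub>i)\<close>, and the argument of \<open>c + \<i> \<mu>\<^sub>i\<close> is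
  \<open>arctan (\<mu>\<^sub>i / c)\<close>. The frame \<open>e\<close> is arbitrary because in the application it is the eigenframe
  at one point, used also at nearby points.
\<close>

lemma det_hessian_eq_polar:
  fixes u :: "real ^ 'n::finite \<Rightarrow> real"
  assumes u: "smooth_on u S" and S: "open S" "x \<in> S" and e: "orthonormal_frame e" and c: "c > 0"
  shows "\<exists>r>0. det (\<chi> j k. (if j = k then complex_of_real c else 0)
      + \<i> * complex_of_real (dir_deriv (e j) (dir_deriv (e k) u) x))
    = complex_of_real r * cis (\<Sum>i<CARD('n). arctan (eigenvalues (hessian u x) ! i / c))"
proof -
  have sym: "transpose (hessian u x) = hessian u x" by (rule transpose_hessian[OF u S])
  obtain b \<mu> where b: "orthonormal_frame b" and eig: "\<And>i. hessian u x *v b i = \<mu> i *\<^sub>R b i"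
    using symmetric_eigenframe[OF sym] by blast
  have Q: "(\<Sum>i\<in>UNIV. (e j \<bullet> b i) * (e k \<bullet> b i)) = (if j = k then 1 else 0)" for j k
    using e by (simp add: orthonormal_frame_inner[OF b, symmetric] orthonormal_frame_def)
  have "det (\<chi> j k. (if j = k then complex_of_real c else 0)
      + \<i> * complex_of_real (dir_deriv (e j) (dir_deriv (e k) u) x))
    = det (\<chi> j k. (if j = k then complex_of_real c else 0)
      + \<i> * complex_of_real (\<Sum>i\<in>UNIV. (e j \<bullet> b i) * \<mu> i * (e k \<bullet> b i)))"
    by (simp only: dir_deriv_dir_deriv_eq_hessian[OF u S] frame_matrix_entry[OF b eig sym])
  also have "\<dots> = (\<Prod>i\<in>UNIV. complex_of_real c + \<i> * complex_of_real (\<mu> i))"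
    by (rule det_shifted_conjugate[OF Q]) auto
  finally show ?thesis
    using prod_eq_polar_sum_arctan[OF c, of \<mu>] sum_eigenvalues[OF b eig sym, of "\<lambda>m. arctan (m / c)"] by metis
qed

text \<open>
  The function \<open>Im (cis (- \<Theta>) * det (c I + \<i> B))\<close> vanishes identically, hence so does its derivative.
  At a diagonal matrix, the logarithmic derivative of the determinant is
  \<open>\<Sum>\<^sub>i (c' + \<i> B'\<^sub>i\<^sub>i) / (c + \<i> \<mu>\<^sub>i)\<close>, whose imaginary part is the sum in the conclusion.
\<close>

lemma linearized_phase_equation:
  fixes c :: "real \<Rightarrow> real" and B :: "real \<Rightarrow> 'n::finite \<Rightarrow> 'n \<Rightarrow> real"
  assumes d: "d > 0" and c: "(c has_real_derivative c1) (at 0)" and pos: "c 0 > 0"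
    and B: "\<And>j k. ((\<lambda>t. B t j k) has_real_derivative B1 j k) (at 0)"
    and diag: "\<And>j k. B 0 j k = (if j = k then \<mu> j else 0)"
    and phase: "\<And>t. \<bar>t\<bar> < d \<Longrightarrow> \<exists>r>0. det (\<chi> j k. (if j = k then complex_of_real (c t) else 0)
      + \<i> * complex_of_real (B t j k)) = complex_of_real r * cis \<Theta>"
  shows "(\<Sum>i\<in>UNIV. (c 0 * B1 i i - \<mu> i * c1) / ((c 0)\<^sup>2 + (\<mu> i)\<^sup>2)) = 0"
proof -
  define M where "M t = (\<chi> j k. (if j = k then complex_of_real (c t) else 0)
      + \<i> * complex_of_real (B t j k))" for t
  define M' where "M' j k = (if j = k then complex_of_real c1 else 0) + \<i> * complex_of_real (B1 j k)" for j k
  define z where "z i = complex_of_real (c 0) + \<i> * complex_of_real (\<mu> i)" for i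
  define L where "L = (\<Sum>i\<in>UNIV. M' i i * (\<Prod>j\<in>UNIV - {i}. M 0 $ j $ j))"
  have z0: "z i \<noteq> 0" for i using pos by (auto simp: z_def complex_eq_iff)
  have M0: "M 0 $ j $ k = (if j = k then z j else 0)" for j k
    by (simp add: M_def diag z_def)
  have "((\<lambda>t. M t $ j $ k) has_vector_derivative M' j k) (at 0)" for j k
  proof -
    show ?thesis
      unfolding M_def M'_def by (cases "j = k") (auto intro!: derivative_eq_intros c B)
  qed
  then have dM: "((\<lambda>t. det (M t)) has_vector_derivative L) (at 0)"
    unfolding L_def by (rule det_has_vector_derivative_at_diagonal) (simp add: M0)
  have "((\<lambda>t. Im (cis (- \<Theta>) * det (M t))) has_vector_derivative Im (cis (- \<Theta>) * L)) (at 0)"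
    by (rule bounded_linear.has_vector_derivative[OF bounded_linear_Im has_vector_derivative_mult_right[OF dM]])
  then have d1: "((\<lambda>t. Im (cis (- \<Theta>) * det (M t))) has_real_derivative Im (cis (- \<Theta>) * L)) (at 0)"
    by (simp add: has_real_derivative_iff_has_vector_derivative)
  have "Im (cis (- \<Theta>) * det (M t)) = 0" if t: "\<bar>t\<bar> < d" for t
  proof -
    obtain r where "det (M t) = complex_of_real r * cis \<Theta>"
      using phase[OF t] unfolding M_def by blast
    then have "cis (- \<Theta>) * det (M t) = complex_of_real r * (cis (- \<Theta>) * cis \<Theta>)" by simp
    also have "\<dots> = complex_of_real r" by (simp only: cis_mult) simp
    finally show ?thesis by simp
  qed
  then have "((\<lambda>t. Im (cis (- \<Theta>) * det (M t))) has_real_derivative 0) (at 0)"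
    using has_field_derivative_transform_within[OF DERIV_const[of 0 "at 0"] d UNIV_I, of
        "\<lambda>t. Im (cis (- \<Theta>) * det (M t))"] by (simp add: dist_real_def)
  with d1 have IL: "Im (cis (- \<Theta>) * L) = 0" by (rule DERIV_unique)
  obtain r where r: "r > 0" "det (M 0) = complex_of_real r * cis \<Theta>"
    using phase[of 0] d unfolding M_def by auto
  have "det (M 0) = (\<Prod>j\<in>UNIV. z j)"
    by (subst det_diagonal) (simp_all add: M0)
  then have prod: "(\<Prod>j\<in>UNIV. z j) = complex_of_real r * cis \<Theta>" using r by simp
  have "L = (\<Sum>i\<in>UNIV. M' i i / z i * (\<Prod>j\<in>UNIV. z j))"
    unfolding L_def
  proof (intro sum.cong refl)
    fix i
    have "(\<Prod>j\<in>UNIV. z j) = z i * (\<Prod>j\<in>UNIV - {i}. z j)" by (intro prod.remove) auto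
    then show "M' i i * (\<Prod>j\<in>UNIV - {i}. M 0 $ j $ j) = M' i i / z i * (\<Prod>j\<in>UNIV. z j)"
      using z0[of i] by (simp add: M0)
  qed
  also have "\<dots> = (\<Sum>i\<in>UNIV. M' i i / z i) * (complex_of_real r * cis \<Theta>)"
    by (simp add: prod sum_distrib_right)
  finally have "cis (- \<Theta>) * L = (\<Sum>i\<in>UNIV. M' i i / z i) * complex_of_real r * (cis (- \<Theta>) * cis \<Theta>)"
    by (simp add: mult_ac)
  also have "\<dots> = complex_of_real r * (\<Sum>i\<in>UNIV. M' i i / z i)"
    by (simp only: cis_mult) simp
  finally have "r * (\<Sum>i\<in>UNIV. Im (M' i i / z i)) = 0"
    using IL by simp
  moreover have "Im (M' i i / z i) = (c 0 * B1 i i - \<mu> i * c1) / ((c 0)\<^sup>2 + (\<mu> i)\<^sup>2)" for i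
    by (simp add: M'_def z_def Im_divide algebra_simps)
  ultimately show ?thesis using r by simp
qed

section \<open>Consequences of a large phase\<close>

text \<open>
  The other \<open>n - 2\<close> angles are at most \<open>\<pi> / 2\<close> each, so the two angles at \<open>i\<close> and \<open>j\<close> add up to
  a nonnegative number.
\<close>

lemma pairwise_sum_nonneg:
  fixes \<mu> :: "'n::finite \<Rightarrow> real"
  assumes c: "c > 0" and \<Theta>: "(\<Sum>i\<in>UNIV. arctan (\<mu> i / c)) \<ge> pi / 2 * (real CARD('n) - 2)"
    and ij: "i \<noteq> j"
  shows "\<mu> i + \<mu> j \<ge> 0"
proof -
  have "(\<Sum>k\<in>UNIV - {i, j}. arctan (\<mu> k / c)) \<le> real (card (UNIV - {i, j})) * (pi / 2)"
    by (intro sum_bounded_above less_imp_le[OF arctan_ubound])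
  moreover have "(\<Sum>k\<in>UNIV. arctan (\<mu> k / c))
      = (\<Sum>k\<in>UNIV - {i, j}. arctan (\<mu> k / c)) + (\<Sum>k\<in>{i, j}. arctan (\<mu> k / c))"
    by (rule sum.subset_diff) auto
  moreover have "real (card (UNIV - {i, j})) = real CARD('n) - 2"
  proof -
    have "2 \<le> CARD('n)" using card_mono[of UNIV "{i, j}"] ij by simp
    then show ?thesis using ij by (simp add: card_Diff_subset of_nat_diff)
  qed
  ultimately have "arctan (\<mu> i / c) + arctan (\<mu> j / c) \<ge> 0"
    using \<Theta> ij by (simp add: mult.commute)
  then have "arctan (- (\<mu> j / c)) \<le> arctan (\<mu> i / c)" by (simp add: arctan_minus)
  then have "- (\<mu> j / c) \<le> \<mu> i / c" by (simp only: arctan_le_iff)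
  then show ?thesis using c by (simp add: field_simps)
qed

section \<open>Optimality conditions for the auxiliary function\<close>

lemma second_derivative_test:
  fixes H :: "real \<Rightarrow> real"
  assumes d: "d > 0" and H: "\<And>t. \<bar>t\<bar> < d \<Longrightarrow> (H has_real_derivative H1 t) (at t)"
    and H1: "(H1 has_real_derivative c) (at 0)" and min: "\<And>t. \<bar>t\<bar> < d \<Longrightarrow> H 0 \<le> H t"
  shows "H1 0 = 0" "c \<ge> 0"
proof -
  show z: "H1 0 = 0"
    using DERIV_local_min[OF H[of 0] d] d min by simp
  show "c \<ge> 0"
  proof (rule ccontr)
    assume "\<not> c \<ge> 0"
    then obtain e where e: "e > 0" "\<And>h. 0 < h \<Longrightarrow> h < e \<Longrightarrow> H1 h < 0"
      using DERIV_neg_dec_right[OF H1] z by auto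
    define h where "h = min d e / 2"
    have h: "0 < h" "h < d" "h < e" using d e by (auto simp: h_def)
    obtain s where s: "0 < s" "s < h" "H h - H 0 = (h - 0) * H1 s"
      using MVT2[of 0 h H H1] h H by auto
    have "h * H1 s < 0" using s h e(2)[of s] by (simp add: mult_pos_neg)
    then show False using s min[of h] h by simp
  qed
qed

text \<open>
  Here \<open>E\<close>, \<open>U\<close> and \<open>q\<close> are the restrictions to a line of \<open>1 - \<bar>x\<bar>\<^sup>2\<close>, of the shifted solution
  and of the components of its gradient. If the maximal value of the auxiliary function is \<open>m\<close>,
  then \<open>H = (m - A U\<^sup>2 / 2)\<^sup>2 - E\<^sup>2 \<Sum>\<^sub>k q\<^sub>k\<^sup>2\<close> is nonnegative and vanishes at \<open>0\<close>. The conclusions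
  are \<open>H' = 0\<close> and \<open>H'' \<ge> 0\<close> at \<open>0\<close>, up to positive factors. Squaring makes the function
  a polynomial in smooth functions, with no square root to differentiate.
\<close>

lemma maximum_along_line_conditions:
  fixes U U1 E E1 :: "real \<Rightarrow> real" and q q1 :: "'k::finite \<Rightarrow> real \<Rightarrow> real"
  assumes d: "d > 0"
    and U: "\<And>t. \<bar>t\<bar> < d \<Longrightarrow> (U has_real_derivative U1 t) (at t)"
    and U1: "(U1 has_real_derivative U2) (at 0)"
    and E: "\<And>t. \<bar>t\<bar> < d \<Longrightarrow> (E has_real_derivative E1 t) (at t)"
    and E1: "(E1 has_real_derivative E2) (at 0)"
    and q: "\<And>k t. \<bar>t\<bar> < d \<Longrightarrow> (q k has_real_derivative q1 k t) (at t)"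
    and q1: "\<And>k. (q1 k has_real_derivative q2 k) (at 0)"
    and nonneg: "\<And>t. \<bar>t\<bar> < d \<Longrightarrow> E t \<ge> 0"
    and max: "\<And>t. \<bar>t\<bar> < d \<Longrightarrow> E t * sqrt (\<Sum>k\<in>UNIV. (q k t)\<^sup>2) + A / 2 * (U t)\<^sup>2 \<le> E 0 * D + A / 2 * (U 0)\<^sup>2"
    and D: "D \<ge> 0" "D\<^sup>2 = (\<Sum>k\<in>UNIV. (q k 0)\<^sup>2)" and E0: "E 0 > 0"
  shows "D * (A * U 0 * U1 0 + E1 0 * D) + E 0 * (\<Sum>k\<in>UNIV. q k 0 * q1 k 0) = 0"
    and "(A * U 0 * U1 0)\<^sup>2 - E 0 * D * A * ((U1 0)\<^sup>2 + U 0 * U2) - (E1 0)\<^sup>2 * D\<^sup>2 - E 0 * E2 * D\<^sup>2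
      - 4 * E 0 * E1 0 * (\<Sum>k\<in>UNIV. q k 0 * q1 k 0)
      - (E 0)\<^sup>2 * (\<Sum>k\<in>UNIV. (q1 k 0)\<^sup>2 + q k 0 * q2 k) \<ge> 0"
proof -
  define m where "m = E 0 * D + A / 2 * (U 0)\<^sup>2"
  define R where "R t = m - A / 2 * (U t)\<^sup>2" for t
  define R1 where "R1 t = - (A * U t * U1 t)" for t
  define N where "N t = (\<Sum>k\<in>UNIV. (q k t)\<^sup>2)" for t
  define N1 where "N1 t = 2 * (\<Sum>k\<in>UNIV. q k t * q1 k t)" for t
  define H where "H t = (R t)\<^sup>2 - (E t)\<^sup>2 * N t" for t
  define H1 where "H1 t = 2 * R t * R1 t - (2 * E t * E1 t * N t + (E t)\<^sup>2 * N1 t)" for t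
  define c where "c = 2 * ((R1 0)\<^sup>2 - R 0 * A * ((U1 0)\<^sup>2 + U 0 * U2))
    - (2 * (E1 0)\<^sup>2 * N 0 + 2 * E 0 * E2 * N 0 + 4 * E 0 * E1 0 * N1 0
      + (E 0)\<^sup>2 * (2 * (\<Sum>k\<in>UNIV. (q1 k 0)\<^sup>2 + q k 0 * q2 k)))"
  have R: "(R has_real_derivative R1 t) (at t)" if "\<bar>t\<bar> < d" for t
    unfolding R_def[abs_def] R1_def by (rule derivative_eq_intros U[OF that] refl | simp)+
  have N: "(N has_real_derivative N1 t) (at t)" if "\<bar>t\<bar> < d" for t
    unfolding N_def[abs_def] N1_def
    by (rule derivative_eq_intros q[OF that] refl | simp add: sum_distrib_left mult_ac)+
  have H: "(H has_real_derivative H1 t) (at t)" if "\<bar>t\<bar> < d" for t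
    unfolding H_def[abs_def] H1_def
    by (rule derivative_eq_intros R[OF that] N[OF that] E[OF that] refl | simp)+
  have zero: "\<bar>0\<bar> < d" using d by simp
  have R1': "(R1 has_real_derivative - (A * ((U1 0)\<^sup>2 + U 0 * U2))) (at 0)"
    unfolding R1_def[abs_def]
    by (rule derivative_eq_intros U[OF zero] U1 refl | simp add: algebra_simps power2_eq_square)+
  have N1': "(N1 has_real_derivative 2 * (\<Sum>k\<in>UNIV. (q1 k 0)\<^sup>2 + q k 0 * q2 k)) (at 0)"
    unfolding N1_def[abs_def]
    by (rule derivative_eq_intros q[OF zero] q1 refl | simp add: algebra_simps power2_eq_square)+
  have H1: "(H1 has_real_derivative c) (at 0)"
    unfolding H1_def[abs_def] c_def
    by (rule derivative_eq_intros R[OF zero] R1' N[OF zero] N1' E[OF zero] E1 refl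
        | simp add: algebra_simps power2_eq_square)+
  have R0: "R 0 = E 0 * D" by (simp add: R_def m_def)
  have N0: "N 0 = D\<^sup>2" by (simp add: N_def D)
  have "H 0 = 0" by (simp add: H_def R0 N0 power_mult_distrib)
  moreover have "H t \<ge> 0" if t: "\<bar>t\<bar> < d" for t
  proof -
    have N: "N t \<ge> 0" by (simp add: N_def sum_nonneg)
    have "E t * sqrt (N t) \<le> R t" using max[OF t] by (simp add: R_def m_def N_def)
    then have "(E t * sqrt (N t))\<^sup>2 \<le> (R t)\<^sup>2"
      using nonneg[OF t] N by (intro power_mono) auto
    then show ?thesis using N by (simp add: H_def power_mult_distrib)
  qed
  ultimately have "H1 0 = 0" "c \<ge> 0"
    using second_derivative_test[OF d H H1] by auto
  have "H1 0 = - 2 * E 0 * (D * (A * U 0 * U1 0 + E1 0 * D) + E 0 * (\<Sum>k\<in>UNIV. q k 0 * q1 k 0))"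
    by (simp add: H1_def R0 N0 R1_def N1_def algebra_simps power2_eq_square)
  with \<open>H1 0 = 0\<close> E0
  show "D * (A * U 0 * U1 0 + E1 0 * D) + E 0 * (\<Sum>k\<in>UNIV. q k 0 * q1 k 0) = 0" by simp
  have "c = 2 * ((A * U 0 * U1 0)\<^sup>2 - E 0 * D * A * ((U1 0)\<^sup>2 + U 0 * U2) - (E1 0)\<^sup>2 * D\<^sup>2 - E 0 * E2 * D\<^sup>2
      - 4 * E 0 * E1 0 * (\<Sum>k\<in>UNIV. q k 0 * q1 k 0)
      - (E 0)\<^sup>2 * (\<Sum>k\<in>UNIV. (q1 k 0)\<^sup>2 + q k 0 * q2 k))"
    by (simp add: c_def R0 N0 R1_def N1_def algebra_simps)
  with \<open>c \<ge> 0\<close>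
  show "(A * U 0 * U1 0)\<^sup>2 - E 0 * D * A * ((U1 0)\<^sup>2 + U 0 * U2) - (E1 0)\<^sup>2 * D\<^sup>2 - E 0 * E2 * D\<^sup>2
      - 4 * E 0 * E1 0 * (\<Sum>k\<in>UNIV. q k 0 * q1 k 0)
      - (E 0)\<^sup>2 * (\<Sum>k\<in>UNIV. (q1 k 0)\<^sup>2 + q k 0 * q2 k) \<ge> 0" by simp
qed

section \<open>The estimate at a maximum point\<close>

text \<open>
  The computation at the maximum point, in terms of numbers only: \<open>p\<close> is the gradient of \<open>u\<close> in
  the eigenframe, \<open>l\<close> the eigenvalues, \<open>g\<close> the gradient of \<open>\<eta>\<close>, \<open>T\<^sub>i = \<Sum>\<^sub>k u\<^sub>k u\<^sub>k\<^sub>i\<^sub>i\<close> and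
  \<open>G = Du \<bullet> Df / f\<close>.
\<close>

lemma gradient_bound_from_conditions:
  fixes p l g T :: "'n::finite \<Rightarrow> real"
  defines "n \<equiv> real CARD('n)"
  assumes n: "n \<ge> 3"
    and D: "D > 0" "D\<^sup>2 = (\<Sum>i\<in>UNIV. (p i)\<^sup>2)"
    and \<eta>: "0 < \<eta>" "\<eta> \<le> 1" and g: "\<And>i. \<bar>g i\<bar> \<le> 2"
    and A: "A > 0" and Av: "2 * n \<le> A * v" "A * v \<le> 4 * n" and f: "f > 0"
    and first: "\<And>i. D * (A * v * p i + g i * D) + \<eta> * (p i * l i) = 0"
    and second: "\<And>i. (A * v * p i)\<^sup>2 - \<eta> * D * A * ((p i)\<^sup>2 + v * l i) - (g i)\<^sup>2 * D\<^sup>2 + 2 * \<eta> * D\<^sup>2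
      - 4 * \<eta> * g i * (p i * l i) - \<eta>\<^sup>2 * ((l i)\<^sup>2 + T i) \<ge> 0"
    and lin: "(\<Sum>i\<in>UNIV. f / (f\<^sup>2 + (l i)\<^sup>2) * T i) = G * (\<Sum>i\<in>UNIV. f / (f\<^sup>2 + (l i)\<^sup>2) * l i)"
    and G: "\<bar>G\<bar> \<le> D * K"
    and pair: "\<And>i j. i \<noteq> j \<Longrightarrow> l i + l j \<ge> 0"
  shows "\<eta> * D * A \<le> n\<^sup>2 * (24 * n\<^sup>2 + 32 * n + 14) * (K\<^sup>2 + 1)"
proof -
  define F where "F i = f / (f\<^sup>2 + (l i)\<^sup>2)" for i
  have den: "f\<^sup>2 + (l i)\<^sup>2 > 0" for i using f by (simp add: add_pos_nonneg)
  have F: "F i > 0" for i using f den by (simp add: F_def)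
  have pD: "(p i)\<^sup>2 \<le> D\<^sup>2" for i
    unfolding D(2) by (intro member_le_sum) auto
  have pD': "\<bar>p i\<bar> \<le> D" for i
    using pD[of i] D(1) by (simp add: abs_le_square_iff[symmetric])
  have Avpos: "A * v > 0" using Av n by linarith
  have g2: "(g i)\<^sup>2 \<le> 4" for i
    using power_mono[OF g[of i], of 2] by simp
  define P where "P = D\<^sup>2 * (24 * n\<^sup>2 + 32 * n + 14)"
  have row: "\<eta> * D * A * (p i)\<^sup>2 + \<eta>\<^sup>2 * (l i)\<^sup>2 / 2 + \<eta>\<^sup>2 * T i \<le> P" for i
  proof -
    \<comment> \<open>The first order condition removes the mixed term containing \<open>l i\<close>.\<close>
    have e1: "4 * \<eta> * g i * (p i * l i) = - (4 * g i * D * (A * v * p i + g i * D))"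
    proof -
      have "- (\<eta> * (p i * l i)) = D * (A * v * p i + g i * D)" using first[of i] by simp
      then have "4 * g i * (- (\<eta> * (p i * l i))) = 4 * g i * (D * (A * v * p i + g i * D))" by simp
      then show ?thesis by (simp add: algebra_simps)
    qed
    have a1: "(A * v * p i)\<^sup>2 \<le> 16 * n\<^sup>2 * D\<^sup>2"
    proof -
      have "(A * v)\<^sup>2 \<le> (4 * n)\<^sup>2" using Av Avpos by (intro power_mono) auto
      then have "(A * v)\<^sup>2 * (p i)\<^sup>2 \<le> (4 * n)\<^sup>2 * D\<^sup>2" using pD by (intro mult_mono) auto
      then show ?thesis by (simp add: power_mult_distrib)
    qed
    \<comment> \<open>Half of the good term \<open>\<eta>\<^sup>2 (l i)\<^sup>2\<close> is spent here, the other half in \<open>lower\<close>.\<close>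
    have a2: "- (\<eta> * D * A * v * l i) \<le> \<eta>\<^sup>2 * (l i)\<^sup>2 / 2 + 8 * n\<^sup>2 * D\<^sup>2"
    proof -
      have "0 \<le> (\<eta> * l i + A * v * D)\<^sup>2" by simp
      then have "- 2 * (\<eta> * l i * (A * v * D)) \<le> (\<eta> * l i)\<^sup>2 + (A * v * D)\<^sup>2"
        by (simp add: power2_sum)
      moreover have "(A * v * D)\<^sup>2 \<le> (4 * n * D)\<^sup>2"
        using Av Avpos D by (intro power_mono mult_right_mono) auto
      ultimately show ?thesis by (simp add: power_mult_distrib algebra_simps)
    qed
    have a3: "2 * \<eta> * D\<^sup>2 \<le> 2 * D\<^sup>2"
      using \<eta> by (intro mult_right_mono) auto
    have a4: "4 * g i * D * (A * v * p i) \<le> 32 * n * D\<^sup>2"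
    proof -
      have "\<bar>g i * (p i * (A * v))\<bar> \<le> 2 * (D * (4 * n))"
        unfolding abs_mult[of "g i"] abs_mult[of "p i"]
        using g[of i] pD'[of i] Av Avpos D(1) by (intro mult_mono) auto
      then have "g i * (p i * (A * v)) \<le> 8 * n * D" by (simp add: abs_le_iff mult_ac)
      then have "(4 * D) * (g i * (p i * (A * v))) \<le> (4 * D) * (8 * n * D)"
        using D by (intro mult_left_mono) auto
      then show ?thesis by (simp add: power2_eq_square algebra_simps)
    qed
    have a5: "3 * (g i)\<^sup>2 * D\<^sup>2 \<le> 12 * D\<^sup>2"
      using g2[of i] by (intro mult_right_mono) auto
    show ?thesis
      using second[of i] a1 a2 a3 a4 a5 unfolding e1 P_def
      by (simp add: algebra_simps power2_eq_square)
  qed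
  \<comment> \<open>The differentiated equation turns third derivatives into first derivatives of \<open>f\<close>.\<close>
  have lower: "- (\<Sum>i\<in>UNIV. F i * ((l i)\<^sup>2 / 2 + D\<^sup>2 * K\<^sup>2 / 2)) \<le> (\<Sum>i\<in>UNIV. F i * T i)"
  proof -
    have K: "D * K \<ge> 0" using G abs_ge_zero[of G] by linarith
    have "G * l i \<ge> - ((l i)\<^sup>2 / 2 + D\<^sup>2 * K\<^sup>2 / 2)" for i
    proof -
      have "0 \<le> (G + l i)\<^sup>2" by simp
      moreover have "G\<^sup>2 \<le> (D * K)\<^sup>2" using G K by (simp add: abs_le_square_iff[symmetric])
      ultimately show ?thesis by (simp add: power2_sum power_mult_distrib)
    qed
    then have "F i * (G * l i) \<ge> F i * (- ((l i)\<^sup>2 / 2 + D\<^sup>2 * K\<^sup>2 / 2))" for i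
      using F[of i] by (intro mult_left_mono) auto
    then have "(\<Sum>i\<in>UNIV. F i * (- ((l i)\<^sup>2 / 2 + D\<^sup>2 * K\<^sup>2 / 2))) \<le> (\<Sum>i\<in>UNIV. F i * (G * l i))"
      by (intro sum_mono)
    also have "\<dots> = (\<Sum>i\<in>UNIV. F i * T i)"
      using lin by (simp add: F_def sum_distrib_left mult_ac)
    finally show ?thesis by (simp only: mult_minus_right sum_negf)
  qed
  have "\<eta> * D * A * (\<Sum>i\<in>UNIV. F i * (p i)\<^sup>2) + \<eta>\<^sup>2 * (\<Sum>i\<in>UNIV. F i * ((l i)\<^sup>2 / 2))
      + \<eta>\<^sup>2 * (\<Sum>i\<in>UNIV. F i * T i)
    = (\<Sum>i\<in>UNIV. F i * (\<eta> * D * A * (p i)\<^sup>2 + \<eta>\<^sup>2 * (l i)\<^sup>2 / 2 + \<eta>\<^sup>2 * T i))"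
    by (simp add: sum_distrib_left sum.distrib algebra_simps)
  also have "\<dots> \<le> (\<Sum>i\<in>UNIV. F i * P)"
    using row F by (intro sum_mono mult_left_mono) (auto intro: less_imp_le)
  finally have up: "\<eta> * D * A * (\<Sum>i\<in>UNIV. F i * (p i)\<^sup>2) + \<eta>\<^sup>2 * (\<Sum>i\<in>UNIV. F i * ((l i)\<^sup>2 / 2))
      + \<eta>\<^sup>2 * (\<Sum>i\<in>UNIV. F i * T i) \<le> (\<Sum>i\<in>UNIV. F i) * P"
    by (simp add: sum_distrib_right)
  have "\<eta>\<^sup>2 * (- (\<Sum>i\<in>UNIV. F i * ((l i)\<^sup>2 / 2 + D\<^sup>2 * K\<^sup>2 / 2))) \<le> \<eta>\<^sup>2 * (\<Sum>i\<in>UNIV. F i * T i)"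
    using lower by (intro mult_left_mono) auto
  moreover have "(\<Sum>i\<in>UNIV. F i * ((l i)\<^sup>2 / 2 + D\<^sup>2 * K\<^sup>2 / 2))
      = (\<Sum>i\<in>UNIV. F i * ((l i)\<^sup>2 / 2)) + (\<Sum>i\<in>UNIV. F i) * (D\<^sup>2 * K\<^sup>2 / 2)"
    by (simp add: sum.distrib sum_distrib_right distrib_left)
  ultimately have up2: "\<eta> * D * A * (\<Sum>i\<in>UNIV. F i * (p i)\<^sup>2)
      \<le> (\<Sum>i\<in>UNIV. F i) * P + \<eta>\<^sup>2 * ((\<Sum>i\<in>UNIV. F i) * (D\<^sup>2 * K\<^sup>2 / 2))"
    using up by (simp add: algebra_simps)
  have SF: "(\<Sum>i\<in>UNIV. F i) \<ge> 0" using F by (intro sum_nonneg) (auto intro: less_imp_le)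
  have "\<eta>\<^sup>2 * ((\<Sum>i\<in>UNIV. F i) * (D\<^sup>2 * K\<^sup>2 / 2)) \<le> 1 * ((\<Sum>i\<in>UNIV. F i) * (D\<^sup>2 * K\<^sup>2 / 2))"
    using \<eta> SF by (intro mult_right_mono) (auto simp: power_le_one)
  with up2 have up3: "\<eta> * D * A * (\<Sum>i\<in>UNIV. F i * (p i)\<^sup>2) \<le> (\<Sum>i\<in>UNIV. F i) * (P + D\<^sup>2 * K\<^sup>2 / 2)"
    by (simp add: algebra_simps)
  have "\<exists>k. (p k)\<^sup>2 * n \<ge> D\<^sup>2"
  proof (rule ccontr)
    assume "\<not> ?thesis"
    then have "(p k)\<^sup>2 * n < D\<^sup>2" for k by (simp add: not_le)
    then have "(\<Sum>k\<in>UNIV. (p k)\<^sup>2 * n) < (\<Sum>k\<in>(UNIV::'n set). D\<^sup>2)"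
      by (intro sum_strict_mono) auto
    then show False by (simp add: D(2) n_def sum_distrib_left mult.commute)
  qed
  then obtain k where k: "(p k)\<^sup>2 * n \<ge> D\<^sup>2" by blast
  have pk: "(p k)\<^sup>2 > 0" using k D n by (smt (verit) zero_less_mult_iff zero_less_power)
  \<comment> \<open>If \<open>l k \<ge> 0\<close>, the term with \<open>A v \<ge> 2 n\<close> in the first order condition outweighs the one with \<open>g k\<close>.\<close>
  have lk: "l k < 0"
  proof (rule ccontr)
    assume "\<not> l k < 0"
    then have "\<eta> * ((p k)\<^sup>2 * l k) \<ge> 0" using \<eta> by simp
    moreover have "D * (A * v * (p k)\<^sup>2 + g k * D * p k) + \<eta> * ((p k)\<^sup>2 * l k)
        = p k * (D * (A * v * p k + g k * D) + \<eta> * (p k * l k))"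
      by (simp add: algebra_simps power2_eq_square)
    ultimately have "D * (A * v * (p k)\<^sup>2 + g k * D * p k) \<le> 0"
      using first[of k] by simp
    then have "A * v * (p k)\<^sup>2 + g k * D * p k \<le> 0"
      using D by (simp add: mult_le_0_iff)
    moreover have "2 * n * (p k)\<^sup>2 \<le> A * v * (p k)\<^sup>2"
      using Av by (intro mult_right_mono) auto
    moreover have "- (g k * D * p k) \<le> 2 * D * \<bar>p k\<bar>"
    proof -
      have "\<bar>g k * (D * p k)\<bar> \<le> 2 * (D * \<bar>p k\<bar>)"
        unfolding abs_mult using g[of k] D by (intro mult_mono) auto
      then show ?thesis by (simp add: mult.assoc)
    qed
    ultimately have "n * (p k)\<^sup>2 \<le> D * \<bar>p k\<bar>" by simp
    then have "(n * \<bar>p k\<bar>) * \<bar>p k\<bar> \<le> D * \<bar>p k\<bar>" by (simp add: power2_eq_square mult.assoc)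
    then have "n * \<bar>p k\<bar> \<le> D" using pk by (simp add: mult_le_cancel_right)
    then have "(n * \<bar>p k\<bar>)\<^sup>2 \<le> D\<^sup>2" using n by (intro power_mono) auto
    then have "n * (n * (p k)\<^sup>2) \<le> n * (p k)\<^sup>2" using k by (simp add: power_mult_distrib power2_eq_square mult_ac)
    then have "n \<le> 1" using pk n by simp
    then show False using n by simp
  qed
  have Fk: "F i \<le> F k" for i
  proof (cases "i = k")
    case False
    then have "\<bar>l k\<bar> \<le> \<bar>l i\<bar>" using pair[of i k] lk by linarith
    then have "(l k)\<^sup>2 \<le> (l i)\<^sup>2" by (simp add: abs_le_square_iff)
    then show ?thesis unfolding F_def using f den by (intro divide_left_mono) (auto intro: mult_pos_pos)
  qed simp
  have "(\<Sum>i\<in>UNIV. F i) \<le> n * F k"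
    using sum_bounded_above[of UNIV F "F k"] Fk by (simp add: n_def)
  moreover have "F k * (p k)\<^sup>2 \<le> (\<Sum>i\<in>UNIV. F i * (p i)\<^sup>2)"
    using F less_imp_le[OF F] by (intro member_le_sum[where f = "\<lambda>i. F i * (p i)\<^sup>2"]) auto
  moreover have "P + D\<^sup>2 * K\<^sup>2 / 2 \<ge> 0" using n by (simp add: P_def)
  ultimately have "\<eta> * D * A * (F k * (p k)\<^sup>2) \<le> (n * F k) * (P + D\<^sup>2 * K\<^sup>2 / 2)"
    using up3 \<eta> D A
    by (meson mult_left_mono mult_right_mono order_trans less_imp_le mult_pos_pos)
  then have "F k * (\<eta> * D * A * (p k)\<^sup>2) \<le> F k * (n * (P + D\<^sup>2 * K\<^sup>2 / 2))" by (simp add: mult_ac)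
  then have "\<eta> * D * A * (p k)\<^sup>2 \<le> n * (P + D\<^sup>2 * K\<^sup>2 / 2)" using F[of k] by simp
  then have "\<eta> * D * A * (p k)\<^sup>2 * n \<le> n * (P + D\<^sup>2 * K\<^sup>2 / 2) * n" using n by (intro mult_right_mono) auto
  moreover have "\<eta> * D * A * D\<^sup>2 \<le> \<eta> * D * A * ((p k)\<^sup>2 * n)" using k \<eta> D A by (intro mult_left_mono) auto
  ultimately have "\<eta> * D * A * D\<^sup>2 \<le> n * (P + D\<^sup>2 * K\<^sup>2 / 2) * n" by (simp add: mult_ac)
  then have "D\<^sup>2 * (\<eta> * D * A) \<le> D\<^sup>2 * (n\<^sup>2 * (24 * n\<^sup>2 + 32 * n + 14 + K\<^sup>2 / 2))"
    by (simp add: P_def algebra_simps power2_eq_square)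
  then have "\<eta> * D * A \<le> n\<^sup>2 * (24 * n\<^sup>2 + 32 * n + 14 + K\<^sup>2 / 2)" using D(1) by simp
  also have "\<dots> \<le> n\<^sup>2 * ((24 * n\<^sup>2 + 32 * n + 14) * (K\<^sup>2 + 1))"
  proof (intro mult_left_mono)
    have "K\<^sup>2 / 2 \<le> 14 * K\<^sup>2" by simp
    also have "\<dots> \<le> (24 * n\<^sup>2 + 32 * n + 14) * K\<^sup>2" using n by (intro mult_right_mono) auto
    finally show "24 * n\<^sup>2 + 32 * n + 14 + K\<^sup>2 / 2 \<le> (24 * n\<^sup>2 + 32 * n + 14) * (K\<^sup>2 + 1)"
      by (simp add: distrib_left)
  qed simp
  finally show ?thesis by (simp add: mult.assoc)
qed

text \<open>
  Translates the situation at an interior maximum point of the auxiliary function into the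
  hypotheses of the preceding lemma, using the eigenframe of the Hessian at that point for all
  derivatives.
\<close>

lemma maximum_point_bound:
  fixes f u :: "real ^ 'n::finite \<Rightarrow> real"
  defines "n \<equiv> real CARD('n)"
  assumes n: "n \<ge> 3" and \<Theta>: "\<Theta> \<ge> pi / 2 * (n - 2)"
    and S: "open S" "ball 0 1 \<subseteq> S" and f: "smooth_on f S" and u: "smooth_on u S"
    and fpos: "\<And>x. x \<in> S \<Longrightarrow> f x > 0"
    and phase: "\<And>x. x \<in> S \<Longrightarrow> (\<Sum>i<CARD('n). arctan (eigenvalues (hessian u x) ! i / f x)) = \<Theta>"
    and x0: "x0 \<in> ball 0 1" and gx0: "grad u x0 \<noteq> 0"
    and K: "norm (grad f x0) \<le> K * f x0"
    and A: "A > 0" "2 * n \<le> A * (u x0 - c)" "A * (u x0 - c) \<le> 4 * n"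
    and max: "\<And>x. x \<in> ball 0 1 \<Longrightarrow> (1 - x \<bullet> x) * norm (grad u x) + A / 2 * (u x - c)\<^sup>2
      \<le> (1 - x0 \<bullet> x0) * norm (grad u x0) + A / 2 * (u x0 - c)\<^sup>2"
  shows "(1 - x0 \<bullet> x0) * norm (grad u x0) * A \<le> n\<^sup>2 * (24 * n\<^sup>2 + 32 * n + 14) * (K\<^sup>2 + 1)"
proof -
  have x0S: "x0 \<in> S" using x0 S by blast
  have sym: "transpose (hessian u x0) = hessian u x0" by (rule transpose_hessian[OF u S(1) x0S])
  obtain e \<mu> where e: "orthonormal_frame e" and eig: "\<And>i. hessian u x0 *v e i = \<mu> i *\<^sub>R e i"
    using symmetric_eigenframe[OF sym] by blast
  have ee: "e i \<bullet> e j = (if i = j then 1 else 0)" for i j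
    using e by (simp add: orthonormal_frame_def)
  have eig2: "dir_deriv (e j) (dir_deriv (e k) u) x0 = (if j = k then \<mu> j else 0)" for j k
    by (simp add: dir_deriv_dir_deriv_eq_hessian[OF u S(1) x0S] eig ee)
  have smu: "smooth_on (dir_deriv v u) S" "smooth_on (dir_deriv w (dir_deriv v u)) S" for v w
    by (intro smooth_on_dir_deriv u)+
  have norm_grad: "norm (grad u x) = sqrt (\<Sum>k\<in>UNIV. (dir_deriv (e k) u x)\<^sup>2)" if "x \<in> S" for x
    unfolding norm_eq_sqrt_inner orthonormal_frame_inner[OF e, of "grad u x" "grad u x"]
    by (simp add: dir_deriv_eq_grad[OF u that] power2_eq_square)
  define d where "d = 1 - norm x0"
  have d: "d > 0" using x0 by (simp add: d_def)
  have ne: "norm (e i) = 1" for i by (simp add: norm_eq_sqrt_inner ee)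
  have inb: "x0 + t *\<^sub>R e i \<in> ball 0 1" if "\<bar>t\<bar> < d" for t i
    using norm_triangle_ineq[of x0 "t *\<^sub>R e i"] that by (simp add: ne d_def)
  have inS: "x0 + t *\<^sub>R e i \<in> S" if "\<bar>t\<bar> < d" for t i
    using inb[OF that] S by blast
  have zero: "\<bar>0::real\<bar> < d" using d by simp
  define \<eta> where "\<eta> = 1 - x0 \<bullet> x0"
  have nx0: "norm x0 < 1" using x0 by simp
  have \<eta>: "0 < \<eta>" "\<eta> \<le> 1"
    using nx0 by (auto simp: \<eta>_def dot_square_norm power_less_one_iff abs_square_less_1)
  define D where "D = norm (grad u x0)"
  define p where "p i = dir_deriv (e i) u x0" for i
  define g where "g i = - 2 * (x0 \<bullet> e i)" for i
  define v where "v = u x0 - c"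
  define T where "T i = (\<Sum>k\<in>UNIV. p k * dir_deriv (e i) (dir_deriv (e i) (dir_deriv (e k) u)) x0)" for i
  have D: "D > 0" "D\<^sup>2 = (\<Sum>i\<in>UNIV. (p i)\<^sup>2)"
  proof -
    show "D > 0" using gx0 by (simp add: D_def)
    show "D\<^sup>2 = (\<Sum>i\<in>UNIV. (p i)\<^sup>2)"
      unfolding D_def norm_grad[OF x0S] p_def by (simp add: sum_nonneg)
  qed
  have g: "\<bar>g i\<bar> \<le> 2" for i
    using Cauchy_Schwarz_ineq2[of x0 "e i"] nx0 by (simp add: g_def ne abs_mult)

  have conds: "D * (A * v * p i + g i * D) + \<eta> * (p i * \<mu> i) = 0"
    "(A * v * p i)\<^sup>2 - \<eta> * D * A * ((p i)\<^sup>2 + v * \<mu> i) - (g i)\<^sup>2 * D\<^sup>2 + 2 * \<eta> * D\<^sup>2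
      - 4 * \<eta> * g i * (p i * \<mu> i) - \<eta>\<^sup>2 * ((\<mu> i)\<^sup>2 + T i) \<ge> 0" for i
  proof -
    define U where "U t = u (x0 + t *\<^sub>R e i) - c" for t
    define U1 where "U1 t = dir_deriv (e i) u (x0 + t *\<^sub>R e i)" for t
    define E where "E t = 1 - (x0 + t *\<^sub>R e i) \<bullet> (x0 + t *\<^sub>R e i)" for t
    define E1 where "E1 t = - 2 * (x0 \<bullet> e i) - 2 * t" for t
    define q where "q k t = dir_deriv (e k) u (x0 + t *\<^sub>R e i)" for k t
    define q1 where "q1 k t = dir_deriv (e i) (dir_deriv (e k) u) (x0 + t *\<^sub>R e i)" for k t
    define q2 where "q2 k = dir_deriv (e i) (dir_deriv (e i) (dir_deriv (e k) u)) x0" for k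
    have U: "(U has_real_derivative U1 t) (at t)" if "\<bar>t\<bar> < d" for t
      unfolding U_def[abs_def] U1_def
      using DERIV_diff[OF dir_deriv_line[OF u inS[OF that]] DERIV_const[of c]] by simp
    have U1: "(U1 has_real_derivative \<mu> i) (at 0)"
      unfolding U1_def[abs_def] using dir_deriv_line[OF smu(1)[of "e i"] inS[OF zero, of i]] eig2[of i i] by simp
    have Et: "E t = \<eta> - 2 * (x0 \<bullet> e i) * t - t\<^sup>2" for t
      by (simp add: E_def \<eta>_def inner_add_left inner_add_right ee inner_commute power2_eq_square)
    have E: "(E has_real_derivative E1 t) (at t)" for t
      unfolding Et[abs_def] E1_def by (auto intro!: derivative_eq_intros)
    have E1: "(E1 has_real_derivative - 2) (at 0)"
      unfolding E1_def[abs_def] by (auto intro!: derivative_eq_intros)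
    have q: "(q k has_real_derivative q1 k t) (at t)" if "\<bar>t\<bar> < d" for k t
      unfolding q_def[abs_def] q1_def by (rule dir_deriv_line[OF smu(1) inS[OF that]])
    have q1: "(q1 k has_real_derivative q2 k) (at 0)" for k
      unfolding q1_def[abs_def] q2_def
      using dir_deriv_line[OF smu(2)[where w = "e i" and v = "e k"] inS[OF zero, of i]] by simp
    have Enn: "E t \<ge> 0" if t: "\<bar>t\<bar> < d" for t
    proof -
      have "norm (x0 + t *\<^sub>R e i) < 1" using inb[OF t] by simp
      then show ?thesis by (simp add: E_def dot_square_norm abs_square_le_1)
    qed
    have at0: "U 0 = v" "U1 0 = p i" "E 0 = \<eta>" "E1 0 = g i" "q k 0 = p k"
      "q1 k 0 = (if i = k then \<mu> i else 0)" for k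
      by (simp_all add: U_def v_def U1_def p_def E_def \<eta>_def E1_def g_def q_def q1_def eig2)
    have m: "E t * sqrt (\<Sum>k\<in>UNIV. (q k t)\<^sup>2) + A / 2 * (U t)\<^sup>2 \<le> E 0 * D + A / 2 * (U 0)\<^sup>2"
      if t: "\<bar>t\<bar> < d" for t
      using max[OF inb[OF t, of i]]
      by (simp add: norm_grad[OF inS[OF t]] E_def q_def U_def D_def)
    have s1: "(\<Sum>k\<in>UNIV. q k 0 * q1 k 0) = p i * \<mu> i"
      by (simp add: at0 if_distrib cong: if_cong)
    have s2: "(\<Sum>k\<in>UNIV. (q1 k 0)\<^sup>2 + q k 0 * q2 k) = (\<mu> i)\<^sup>2 + T i"
      by (simp add: at0 sum.distrib T_def q2_def if_distrib[of "\<lambda>z. z\<^sup>2"] cong: if_cong)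
    have D0: "D\<^sup>2 = (\<Sum>k\<in>UNIV. (q k 0)\<^sup>2)" by (simp add: at0 D)
    have E0: "E 0 > 0" using \<eta> by (simp add: at0)
    have tc1: "D * (A * U 0 * U1 0 + E1 0 * D) + E 0 * (\<Sum>k\<in>UNIV. q k 0 * q1 k 0) = 0"
      by (rule maximum_along_line_conditions(1)[OF d U U1 E E1 q q1 Enn m less_imp_le[OF D(1)] D0 E0])
    show "D * (A * v * p i + g i * D) + \<eta> * (p i * \<mu> i) = 0"
      using tc1 unfolding s1 unfolding at0 .
    have tc2: "(A * U 0 * U1 0)\<^sup>2 - E 0 * D * A * ((U1 0)\<^sup>2 + U 0 * \<mu> i) - (E1 0)\<^sup>2 * D\<^sup>2 - E 0 * (- 2) * D\<^sup>2
      - 4 * E 0 * E1 0 * (\<Sum>k\<in>UNIV. q k 0 * q1 k 0)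
      - (E 0)\<^sup>2 * (\<Sum>k\<in>UNIV. (q1 k 0)\<^sup>2 + q k 0 * q2 k) \<ge> 0"
      by (rule maximum_along_line_conditions(2)[OF d U U1 E E1 q q1 Enn m less_imp_le[OF D(1)] D0 E0])
    show "(A * v * p i)\<^sup>2 - \<eta> * D * A * ((p i)\<^sup>2 + v * \<mu> i) - (g i)\<^sup>2 * D\<^sup>2 + 2 * \<eta> * D\<^sup>2
      - 4 * \<eta> * g i * (p i * \<mu> i) - \<eta>\<^sup>2 * ((\<mu> i)\<^sup>2 + T i) \<ge> 0"
      using tc2 unfolding s1 s2 unfolding at0 by simp
  qed

  define G where "G = (\<Sum>k\<in>UNIV. p k * dir_deriv (e k) f x0) / f x0"
  have f0: "f x0 > 0" by (rule fpos[OF x0S])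
  have lin_k: "(\<Sum>i\<in>UNIV. f x0 / ((f x0)\<^sup>2 + (\<mu> i)\<^sup>2) * dir_deriv (e i) (dir_deriv (e i) (dir_deriv (e k) u)) x0)
      = dir_deriv (e k) f x0 / f x0 * (\<Sum>i\<in>UNIV. f x0 / ((f x0)\<^sup>2 + (\<mu> i)\<^sup>2) * \<mu> i)" for k
  proof -
    define B where "B t i j = dir_deriv (e i) (dir_deriv (e j) u) (x0 + t *\<^sub>R e k)" for t i j
    define B1 where "B1 i j = dir_deriv (e k) (dir_deriv (e i) (dir_deriv (e j) u)) x0" for i j
    have "(\<Sum>i\<in>UNIV. (f (x0 + 0 *\<^sub>R e k) * B1 i i - \<mu> i * dir_deriv (e k) f x0) / ((f (x0 + 0 *\<^sub>R e k))\<^sup>2 + (\<mu> i)\<^sup>2)) = 0"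
    proof (rule linearized_phase_equation[where c = "\<lambda>t. f (x0 + t *\<^sub>R e k)" and B = B and ?B1.0 = B1
          and \<mu> = \<mu> and \<Theta> = \<Theta>, OF d])
      show "((\<lambda>t. f (x0 + t *\<^sub>R e k)) has_real_derivative dir_deriv (e k) f x0) (at 0)"
        using dir_deriv_line[OF f inS[OF zero, of k]] by simp
      show "((\<lambda>t. B t i j) has_real_derivative B1 i j) (at 0)" for i j
        unfolding B_def B1_def
        using dir_deriv_line[OF smu(2)[where w = "e i" and v = "e j"] inS[OF zero, of k]] by simp
      show "\<exists>r>0. det (\<chi> i j. (if i = j then complex_of_real (f (x0 + t *\<^sub>R e k)) else 0)
          + \<i> * complex_of_real (B t i j)) = complex_of_real r * cis \<Theta>" if t: "\<bar>t\<bar> < d" for t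
        unfolding B_def phase[OF inS[OF t, of k], symmetric]
        by (rule det_hessian_eq_polar[OF u S(1) inS[OF t] e fpos[OF inS[OF t]]])
    qed (use f0 in \<open>simp_all add: B_def eig2\<close>)
    \<comment> \<open>Third derivatives may be taken in any order.\<close>
    moreover have "B1 i i = dir_deriv (e i) (dir_deriv (e i) (dir_deriv (e k) u)) x0" for i
    proof -
      have "B1 i i = dir_deriv (e i) (dir_deriv (e k) (dir_deriv (e i) u)) x0"
        unfolding B1_def by (rule dir_deriv_commute[OF S(1) x0S smu(1)])
      also have "\<dots> = dir_deriv (e i) (dir_deriv (e i) (dir_deriv (e k) u)) x0"
        by (rule dir_deriv_cong[OF S(1) x0S dir_deriv_commute[OF S(1) _ u] smu(2)])
      finally show ?thesis .
    qed
    ultimately have "(\<Sum>i\<in>UNIV. (f x0 * dir_deriv (e i) (dir_deriv (e i) (dir_deriv (e k) u)) x0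
        - \<mu> i * dir_deriv (e k) f x0) / ((f x0)\<^sup>2 + (\<mu> i)\<^sup>2)) = 0" by simp
    then have "(\<Sum>i\<in>UNIV. f x0 / ((f x0)\<^sup>2 + (\<mu> i)\<^sup>2) * dir_deriv (e i) (dir_deriv (e i) (dir_deriv (e k) u)) x0)
      = (\<Sum>i\<in>UNIV. \<mu> i * dir_deriv (e k) f x0 / ((f x0)\<^sup>2 + (\<mu> i)\<^sup>2))"
      by (simp add: diff_divide_distrib sum_subtractf)
    then show ?thesis using f0 by (simp add: sum_distrib_left mult_ac)
  qed
  have lin: "(\<Sum>i\<in>UNIV. f x0 / ((f x0)\<^sup>2 + (\<mu> i)\<^sup>2) * T i)
      = G * (\<Sum>i\<in>UNIV. f x0 / ((f x0)\<^sup>2 + (\<mu> i)\<^sup>2) * \<mu> i)"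
  proof -
    have "(\<Sum>i\<in>UNIV. f x0 / ((f x0)\<^sup>2 + (\<mu> i)\<^sup>2) * T i)
      = (\<Sum>i\<in>UNIV. \<Sum>k\<in>UNIV. p k * (f x0 / ((f x0)\<^sup>2 + (\<mu> i)\<^sup>2) *
          dir_deriv (e i) (dir_deriv (e i) (dir_deriv (e k) u)) x0))"
      by (simp add: T_def sum_distrib_left mult_ac)
    also have "\<dots> = (\<Sum>k\<in>UNIV. \<Sum>i\<in>UNIV. p k * (f x0 / ((f x0)\<^sup>2 + (\<mu> i)\<^sup>2) *
          dir_deriv (e i) (dir_deriv (e i) (dir_deriv (e k) u)) x0))"
      by (rule sum.swap)
    also have "\<dots> = (\<Sum>k\<in>UNIV. p k * (dir_deriv (e k) f x0 / f x0 *
          (\<Sum>i\<in>UNIV. f x0 / ((f x0)\<^sup>2 + (\<mu> i)\<^sup>2) * \<mu> i)))"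
      by (simp only: sum_distrib_left[symmetric] lin_k)
    also have "\<dots> = G * (\<Sum>i\<in>UNIV. f x0 / ((f x0)\<^sup>2 + (\<mu> i)\<^sup>2) * \<mu> i)"
      by (simp add: G_def sum_distrib_right sum_divide_distrib mult.assoc)
    finally show ?thesis .
  qed
  have "\<bar>G\<bar> \<le> D * K"
  proof -
    have "(\<Sum>k\<in>UNIV. p k * dir_deriv (e k) f x0) = grad u x0 \<bullet> grad f x0"
      unfolding orthonormal_frame_inner[OF e, of "grad u x0" "grad f x0"]
      by (simp add: p_def dir_deriv_eq_grad[OF u x0S] dir_deriv_eq_grad[OF f x0S])
    then have "\<bar>G\<bar> \<le> D * norm (grad f x0) / f x0"
      using f0 Cauchy_Schwarz_ineq2[of "grad u x0" "grad f x0"]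
      by (simp add: G_def D_def divide_right_mono)
    also have "\<dots> \<le> D * (K * f x0) / f x0"
      using K f0 D(1) by (intro divide_right_mono mult_left_mono) auto
    finally show ?thesis using f0 by simp
  qed
  moreover have "\<mu> i + \<mu> j \<ge> 0" if "i \<noteq> j" for i j
  proof (rule pairwise_sum_nonneg[OF f0 _ that])
    show "pi / 2 * (real CARD('n) - 2) \<le> (\<Sum>i\<in>UNIV. arctan (\<mu> i / f x0))"
      using phase[OF x0S] \<Theta> sum_eigenvalues[OF e eig sym, of "\<lambda>m. arctan (m / f x0)"]
      by (simp add: n_def)
  qed
  ultimately have "\<eta> * D * A \<le> n\<^sup>2 * (24 * n\<^sup>2 + 32 * n + 14) * (K\<^sup>2 + 1)"
    unfolding n_def
    by (intro gradient_bound_from_conditions[where p = p and l = \<mu> and g = g and T = T and v = v and f = "f x0" and G = G])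
      (use n A D \<eta> g f0 conds lin in \<open>simp_all add: n_def v_def\<close>)
  then show ?thesis by (simp add: \<eta>_def D_def)
qed

section \<open>The gradient estimate\<close>

text \<open>
  The set where a continuous function exceeds its essential supremum over an open ball is open and
  null, hence empty. Continuity on the closed ball makes the essential supremum finite, so that its
  conversion to a real number keeps its value.
\<close>

lemma norm_le_Linf_norm_ball:
  fixes g :: "'a::euclidean_space \<Rightarrow> 'b::real_normed_vector"
  assumes g: "continuous_on (cball a r) g" and x: "x \<in> ball a r"
  shows "norm (g x) \<le> Linf_norm (ball a r) g"
proof -
  let ?h = "\<lambda>x. ereal (norm (g x))"
  define E where "E = esssup (lebesgue_on (ball a r)) ?h"
  have gb: "continuous_on (ball a r) g" using g continuous_on_subset ball_subset_cball by blast
  have "(\<lambda>x. norm (g x)) \<in> borel_measurable (lebesgue_on (ball a r))"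
    using gb by (intro continuous_imp_measurable_on_sets_lebesgue continuous_intros) auto
  then have meas: "?h \<in> borel_measurable (lebesgue_on (ball a r))" by measurable
  have "bounded (g ` cball a r)"
    using g by (intro compact_imp_bounded compact_continuous_image) auto
  then obtain b where b: "\<And>y. y \<in> cball a r \<Longrightarrow> norm (g y) \<le> b"
    unfolding bounded_iff by blast
  have up: "E \<le> ereal b"
    unfolding E_def
    by (rule esssup_I[OF meas]) (use b in \<open>auto intro!: AE_I2 simp: space_restrict_space\<close>)
  have low: "?h x \<le> E"
  proof (rule ccontr)
    assume less: "\<not> ?h x \<le> E"
    define U where "U = {y \<in> ball a r. ?h y > E}"
    have "open U"
    proof -
      have "continuous_on (ball a r) ?h"
        using gb by (intro continuous_on_ereal continuous_intros)
      then have "open (?h -` {E<..} \<inter> ball a r)"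
        using continuous_on_open_vimage open_greaterThan open_ball by blast
      moreover have "U = ?h -` {E<..} \<inter> ball a r" by (auto simp: U_def)
      ultimately show ?thesis by simp
    qed
    moreover have "x \<in> U" using x less by (simp add: U_def)
    ultimately have "\<not> negligible U" using open_not_negligible by blast
    moreover have "negligible U"
    proof -
      have "AE y in lebesgue_on (ball a r). ?h y \<le> E"
        unfolding E_def by (rule esssup_AE)
      then have "AE y in lebesgue. y \<in> ball a r \<longrightarrow> ?h y \<le> E"
        by (subst (asm) AE_restrict_space_iff) auto
      then have "AE y in lebesgue. y \<notin> U"
        by eventually_elim (auto simp: U_def)
      moreover have "U \<in> sets lebesgue" using \<open>open U\<close> by simp
      ultimately show ?thesis
        by (simp add: negligible_iff_null_sets AE_iff_null_sets)
    qed
    ultimately show False by blast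
  qed
  have "Linf_norm (ball a r) g = real_of_ereal E" by (simp add: Linf_norm_def E_def)
  then show ?thesis using up low by (cases E) auto
qed

lemma gradient_estimate_large_phase:
  fixes f u :: "real ^ 'n::finite \<Rightarrow> real"
  defines "n \<equiv> real CARD('n)"
  assumes n: "n \<ge> 3" and \<Theta>: "\<Theta> \<ge> pi / 2 * (n - 2)"
    and f: "smooth_on f (ball 0 2)" and u: "smooth_on u (ball 0 2)"
    and fpos: "\<And>x. x \<in> ball 0 2 \<Longrightarrow> f x > 0"
    and phase: "\<And>x. x \<in> ball 0 2 \<Longrightarrow> (\<Sum>i<CARD('n). arctan (eigenvalues (hessian u x) ! i / f x)) = \<Theta>"
    and K: "\<And>x. x \<in> ball 0 1 \<Longrightarrow> norm (grad f x) \<le> K * f x"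
    and M: "M > 0" "\<And>x. x \<in> ball 0 1 \<Longrightarrow> M \<le> u x - c" "\<And>x. x \<in> ball 0 1 \<Longrightarrow> u x - c \<le> 2 * M"
  shows "norm (grad u 0) \<le> (n * (12 * n\<^sup>2 + 16 * n + 7) + 4 * n) * (K\<^sup>2 + 1) * M"
proof -
  define A where "A = 2 * n / M"
  define w where "w x = (1 - x \<bullet> x) * norm (grad u x) + A / 2 * (u x - c)\<^sup>2" for x
  have A: "A > 0" "A * M = 2 * n" using n M(1) by (simp_all add: A_def)
  have sub: "cball 0 1 \<subseteq> ball (0 :: real ^ 'n) 2" "ball 0 1 \<subseteq> ball (0 :: real ^ 'n) 2" by auto
  have cu: "continuous_on (cball 0 1) u"
    using smooth_on_continuous_on[OF u] sub continuous_on_subset by blast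
  have cg: "continuous_on (cball 0 1) (grad u)"
    using continuous_on_grad[OF u] sub continuous_on_subset by blast
  have cl: "closure (ball 0 1) = cball (0 :: real ^ 'n) 1" by simp
  have lo: "M \<le> u x - c" if "x \<in> cball 0 1" for x
    by (rule continuous_ge_on_closure[where S = "ball 0 1" and f = "\<lambda>x. u x - c"])
      (use that M cu in \<open>auto intro!: continuous_intros simp: cl\<close>)
  have hi: "u x - c \<le> 2 * M" if "x \<in> cball 0 1" for x
    by (rule continuous_le_on_closure[where S = "ball 0 1" and f = "\<lambda>x. u x - c"])
      (use that M cu in \<open>auto intro!: continuous_intros simp: cl\<close>)
  have "continuous_on (cball 0 1) w"
    unfolding w_def[abs_def] using cu cg by (intro continuous_intros)
  then obtain x0 where x0: "x0 \<in> cball 0 1" and max: "\<And>x. x \<in> cball 0 1 \<Longrightarrow> w x \<le> w x0"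
    using continuous_attains_sup[of "cball 0 1" w] by fastforce
  have quad: "A / 2 * (u x0 - c)\<^sup>2 \<le> 4 * n * M"
  proof -
    have "(u x0 - c)\<^sup>2 \<le> (2 * M)\<^sup>2" using lo[OF x0] hi[OF x0] M(1) by (intro power_mono) auto
    then have "A / 2 * (u x0 - c)\<^sup>2 \<le> A / 2 * (2 * M)\<^sup>2" using A by (intro mult_left_mono) auto
    also have "\<dots> = 2 * (A * M) * M" by (simp add: power2_eq_square)
    finally show ?thesis by (simp add: A)
  qed
  define Q where "Q = 12 * n\<^sup>2 + 16 * n + 7"
  have Q: "Q \<ge> 0" using n by (simp add: Q_def)
  have main: "(1 - x0 \<bullet> x0) * norm (grad u x0) \<le> n * Q * (K\<^sup>2 + 1) * M"
  proof (cases "x0 \<in> ball 0 1 \<and> grad u x0 \<noteq> 0")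
    case True
    have "(1 - x0 \<bullet> x0) * norm (grad u x0) * A \<le> n\<^sup>2 * (24 * n\<^sup>2 + 32 * n + 14) * (K\<^sup>2 + 1)"
      unfolding n_def
    proof (rule maximum_point_bound[where f = f and u = u and S = "ball 0 2" and c = c and \<Theta> = \<Theta>])
      show "2 * real CARD('n) \<le> A * (u x0 - c)"
        using mult_left_mono[OF lo[OF x0], of A] A by (simp add: n_def)
      show "A * (u x0 - c) \<le> 4 * real CARD('n)"
      proof -
        have "A * (u x0 - c) \<le> A * (2 * M)" using hi[OF x0] A(1) by (intro mult_left_mono) auto
        also have "\<dots> = 2 * (A * M)" by simp
        finally show ?thesis by (simp add: A(2) n_def)
      qed
      show "(1 - x \<bullet> x) * norm (grad u x) + A / 2 * (u x - c)\<^sup>2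
        \<le> (1 - x0 \<bullet> x0) * norm (grad u x0) + A / 2 * (u x0 - c)\<^sup>2" if "x \<in> ball 0 1" for x
        using max[of x] that by (simp add: w_def)
    qed (use n \<Theta> f u fpos phase K A sub True in \<open>auto simp: n_def\<close>)
    then have "(1 - x0 \<bullet> x0) * norm (grad u x0) * A * M \<le> n\<^sup>2 * (24 * n\<^sup>2 + 32 * n + 14) * (K\<^sup>2 + 1) * M"
      using M(1) by (intro mult_right_mono) auto
    moreover have "(1 - x0 \<bullet> x0) * norm (grad u x0) * A * M = (2 * n) * ((1 - x0 \<bullet> x0) * norm (grad u x0))"
      using A by (simp add: mult.assoc)
    moreover have "n\<^sup>2 * (24 * n\<^sup>2 + 32 * n + 14) * (K\<^sup>2 + 1) * M = (2 * n) * (n * Q * (K\<^sup>2 + 1) * M)"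
      by (simp add: Q_def power2_eq_square algebra_simps)
    ultimately have "(2 * n) * ((1 - x0 \<bullet> x0) * norm (grad u x0)) \<le> (2 * n) * (n * Q * (K\<^sup>2 + 1) * M)"
      by simp
    then show ?thesis using n by simp
  next
    case False
    have "norm x0 = 1 \<or> grad u x0 = 0" using False x0 by auto
    then have "(1 - x0 \<bullet> x0) * norm (grad u x0) = 0" by (auto simp: dot_square_norm)
    also have "0 \<le> n * Q * (K\<^sup>2 + 1) * M" using n Q M(1) by simp
    finally show ?thesis .
  qed
  have "norm (grad u 0) \<le> w 0" using A by (simp add: w_def)
  also have "\<dots> \<le> w x0" by (rule max) simp
  also have "\<dots> \<le> n * Q * (K\<^sup>2 + 1) * M + 4 * n * M"
    unfolding w_def using main quad by linarith
  also have "\<dots> \<le> n * Q * (K\<^sup>2 + 1) * M + 4 * n * (K\<^sup>2 + 1) * M"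
    using n M(1) by (intro add_left_mono mult_right_mono) auto
  finally show ?thesis by (simp add: Q_def distrib_right)
qed

lemma sum_arctan_eigenvalues_minus:
  fixes H :: "real ^ 'n ^ 'n::finite"
  assumes sym: "transpose H = H"
  shows "(\<Sum>i<CARD('n). arctan (eigenvalues (- H) ! i / c)) = - (\<Sum>i<CARD('n). arctan (eigenvalues H ! i / c))"
proof -
  obtain b \<mu> where b: "orthonormal_frame b" and eig: "\<And>i. H *v b i = \<mu> i *\<^sub>R b i"
    using symmetric_eigenframe[OF sym] by blast
  have eig': "(- H) *v b i = (- \<mu> i) *\<^sub>R b i" for i
  proof -
    have "(- H) *v b i = - (H *v b i)"
      by (simp add: vec_eq_iff matrix_vector_mult_def sum_negf)
    then show ?thesis by (simp add: eig)
  qed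
  have sym': "transpose (- H) = - H"
    using sym by (simp add: vec_eq_iff transpose_def)
  show ?thesis
    using sum_eigenvalues[OF b eig sym, of "\<lambda>m. arctan (m / c)"]
      sum_eigenvalues[OF b eig' sym', of "\<lambda>m. arctan (m / c)"]
    by (simp add: arctan_minus sum_negf)
qed

lemma gradient_estimate:
  fixes f u :: "real ^ 'n::finite \<Rightarrow> real"
  defines "n \<equiv> real CARD('n)"
  assumes n: "n \<ge> 3" and \<Theta>: "\<bar>\<Theta>\<bar> \<ge> pi / 2 * (n - 2)"
    and f: "smooth_on f (ball 0 2)" and u: "smooth_on u (ball 0 2)"
    and fpos: "\<And>x. x \<in> ball 0 2 \<Longrightarrow> f x > 0"
    and phase: "\<And>x. x \<in> ball 0 2 \<Longrightarrow> (\<Sum>i<CARD('n). arctan (eigenvalues (hessian u x) ! i / f x)) = \<Theta>"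
    and K: "\<And>x. x \<in> ball 0 1 \<Longrightarrow> norm (grad f x) \<le> K * f x"
    and M: "M > 0" "\<And>x. x \<in> ball 0 1 \<Longrightarrow> M \<le> u x - c" "\<And>x. x \<in> ball 0 1 \<Longrightarrow> u x - c \<le> 2 * M"
  shows "norm (grad u 0) \<le> (n * (12 * n\<^sup>2 + 16 * n + 7) + 4 * n) * (K\<^sup>2 + 1) * M"
proof (cases "\<Theta> \<ge> pi / 2 * (n - 2)")
  case True
  then show ?thesis
    using gradient_estimate_large_phase[of \<Theta> f u K M c] n f u fpos phase K M unfolding n_def by blast
next
  case False
  then have \<Theta>': "- \<Theta> \<ge> pi / 2 * (n - 2)" using \<Theta> by linarith
  have phase': "(\<Sum>i<CARD('n). arctan (eigenvalues (hessian (\<lambda>x. - u x) x) ! i / f x)) = - \<Theta>"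
    if x: "x \<in> ball 0 2" for x
    unfolding hessian_minus[OF open_ball x u] phase[OF x, symmetric]
    by (rule sum_arctan_eigenvalues_minus[OF transpose_hessian[OF u open_ball x]])
  have "norm (grad (\<lambda>x. - u x) 0) \<le> (n * (12 * n\<^sup>2 + 16 * n + 7) + 4 * n) * (K\<^sup>2 + 1) * M"
    unfolding n_def
  \<comment> \<open>With this shift, the values \<open>y\<close> of \<open>u - c\<close> turn into \<open>3 M - y\<close>.\<close>
  proof (rule gradient_estimate_large_phase[where \<Theta> = "- \<Theta>" and f = f and c = "- c - 3 * M"])
    show "M \<le> - u x - (- c - 3 * M)" if "x \<in> ball 0 1" for x using M(3)[OF that] by simp
    show "- u x - (- c - 3 * M) \<le> 2 * M" if "x \<in> ball 0 1" for x using M(2)[OF that] by simp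
  qed (use n \<Theta>' f smooth_on_minus[OF open_ball u] fpos phase' K M in \<open>auto simp: n_def\<close>)
  moreover have "grad (\<lambda>x. - u x) 0 = - grad u 0"
    using dir_deriv_minus[OF u, of 0] by (simp add: vec_eq_iff grad_def partial_deriv_eq_dir_deriv)
  ultimately show ?thesis by simp
qed

text \<open>
  A positive lower bound comparable to the upper bound is what lets the auxiliary function use the
  square of the shifted function: the derivative of the square then keeps its size and sign.
\<close>

lemma exists_shift_of_osc_le:
  fixes u :: "'a \<Rightarrow> real"
  assumes bdd: "bdd_above (u ` S)" "bdd_below (u ` S)" and M: "osc S u \<le> M"
  shows "\<exists>c. \<forall>x\<in>S. M \<le> u x - c \<and> u x - c \<le> 2 * M"
proof (intro exI ballI)
  fix x assume x: "x \<in> S"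
  show "M \<le> u x - ((INF x\<in>S. u x) - M) \<and> u x - ((INF x\<in>S. u x) - M) \<le> 2 * M"
    using cINF_lower[OF bdd(2) x] cSUP_upper[OF x bdd(1)] M by (simp add: osc_def)
qed

theorem theorem1p2:
  assumes "CARD('n::finite) \<ge> 3"
  shows "\<exists>C::real. \<forall>(\<Theta>::real) (f :: real ^ 'n \<Rightarrow> real) (u :: real ^ 'n \<Rightarrow> real).
    \<bar>\<Theta>\<bar> \<ge> pi / 2 * (real CARD('n) - 2) \<longrightarrow>
    smooth_on f (ball 0 2) \<longrightarrow>
    (\<forall>x\<in>ball 0 2. f x > 0) \<longrightarrow>
    smooth_on u (ball 0 2) \<longrightarrow>
    (\<forall>x\<in>ball 0 2. (\<Sum>i<CARD('n). arctan (eigenvalues (hessian u x) ! i / f x)) = \<Theta>) \<longrightarrow>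
    norm (grad u 0) \<le>
      C * ((Linf_norm (ball 0 1) (\<lambda>x. grad f x /\<^sub>R f x))\<^sup>2 + 1) * osc (ball 0 1) u"
proof -
  define n where "n = real CARD('n)"
  define C where "C = n * (12 * n\<^sup>2 + 16 * n + 7) + 4 * n"
  have n: "n \<ge> 3" using assms by (simp add: n_def)
  then have C: "C > 0" by (simp add: C_def add_pos_pos)
  show ?thesis
  proof (intro exI[of _ C] allI impI)
    fix \<Theta> and f u :: "real ^ 'n \<Rightarrow> real"
    assume \<Theta>: "\<bar>\<Theta>\<bar> \<ge> pi / 2 * (real CARD('n) - 2)"
      and f: "smooth_on f (ball 0 2)" and fpos: "\<forall>x\<in>ball 0 2. f x > 0"
      and u: "smooth_on u (ball 0 2)"
      and phase: "\<forall>x\<in>ball 0 2. (\<Sum>i<CARD('n). arctan (eigenvalues (hessian u x) ! i / f x)) = \<Theta>"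
    define K where "K = Linf_norm (ball 0 1) (\<lambda>x. grad f x /\<^sub>R f x)"
    have sub: "cball 0 1 \<subseteq> ball (0 :: real ^ 'n) 2" by auto
    have K: "norm (grad f x) \<le> K * f x" if x: "x \<in> ball 0 1" for x
    proof -
      have pos: "f y > 0" if "y \<in> cball 0 1" for y using fpos sub that by blast
      have "continuous_on (cball 0 1) (\<lambda>x. grad f x /\<^sub>R f x)"
      proof (intro continuous_intros)
        show "continuous_on (cball 0 1) f" "continuous_on (cball 0 1) (grad f)"
          using continuous_on_subset[OF smooth_on_continuous_on[OF f] sub]
            continuous_on_subset[OF continuous_on_grad[OF f] sub] by auto
        show "\<forall>x\<in>cball 0 1. f x \<noteq> 0" using pos by force
      qed
      from norm_le_Linf_norm_ball[OF this x] have "norm (grad f x) / f x \<le> K"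
        using pos[of x] x by (simp add: K_def divide_inverse mult.commute)
      then show ?thesis using pos[of x] x by (simp add: pos_divide_le_eq)
    qed
    have bounded: "bounded (u ` ball 0 1)"
    proof -
      have "compact (u ` cball 0 1)"
        using continuous_on_subset[OF smooth_on_continuous_on[OF u] sub]
        by (intro compact_continuous_image) auto
      then show ?thesis
        using compact_imp_bounded bounded_subset image_mono ball_subset_cball by meson
    qed
    have bdd: "bdd_above (u ` ball 0 1)" "bdd_below (u ` ball 0 1)"
      using bounded bounded_imp_bdd_above bounded_imp_bdd_below by auto
    have osc0: "osc (ball 0 1) u \<ge> 0"
      using cINF_lower[OF bdd(2), of 0] cSUP_upper[OF _ bdd(1), of 0] by (simp add: osc_def)
    \<comment> \<open>A strict inequality gives \<open>M > 0\<close> even when \<open>u\<close> is constant on the ball.\<close>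
    have est: "norm (grad u 0) \<le> C * (K\<^sup>2 + 1) * M" if M: "M > osc (ball 0 1) u" for M
    proof -
      obtain c where c: "\<forall>x\<in>ball 0 1. M \<le> u x - c \<and> u x - c \<le> 2 * M"
        using exists_shift_of_osc_le[OF bdd less_imp_le[OF M]] by blast
      have "M > 0" using M osc0 by linarith
      then show ?thesis
        unfolding C_def n_def
        by (intro gradient_estimate[where f = f and \<Theta> = \<Theta> and c = c])
          (use n \<Theta> f u fpos phase K c in \<open>auto simp: n_def\<close>)
    qed
    have CK: "C * (K\<^sup>2 + 1) > 0" using C by (simp add: add_nonneg_pos)
    have "norm (grad u 0) / (C * (K\<^sup>2 + 1)) \<le> osc (ball 0 1) u"
    proof (rule dense_ge)
      fix M assume "osc (ball 0 1) u < M"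
      from est[OF this] CK show "norm (grad u 0) / (C * (K\<^sup>2 + 1)) \<le> M"
        by (simp add: pos_divide_le_eq mult.commute)
    qed
    then show "norm (grad u 0) \<le> C * ((Linf_norm (ball 0 1) (\<lambda>x. grad f x /\<^sub>R f x))\<^sup>2 + 1) * osc (ball 0 1) u"
      using CK by (simp add: pos_divide_le_eq mult.commute K_def)
  qed
qed

end
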